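(* Let $\mathsf{H}$ be a quaternionic Hilbert space and let $\mathfrak{B}(\mathsf{H})$ be the set of all bounded (right $\mathbb{H}$-linear) operators of $\mathsf{H}$. Given any normal operator $T\in\mathfrak{B}(\mathsf{H})$, there exist three operators $A,B,J\in\mathfrak{B}(\mathsf{H})$ such that: (i) $T=A+JB$; (ii) $A$ is self-adjoint and $B$ is positive; (iii) $J$ is anti self-adjoint and unitary; (iv) $A$, $B$ and $J$ commute mutually. Furthermore, the following additional facts hold: - $A$ and $B$ are uniquely determined by $T$: $A=(T+T^* )\frac12$ and $B=|T-T^*|\frac12$. - $J$ is uniquely determined by $T$ on $\mathrm{Ker}(T-T^* )^\perp$ (that is, for any two triples $(A,B,J)$, $(A,B,J')$ satisfying (i)--(iv), $J$ and $J'$ coincide on $\mathrm{Ker}(T-T^* )^\perp$).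
   Context: $\mathbb{H}$ denotes the real division algebra of quaternions, with conjugation $q\mapsto\overline q$ and norm $|q|=\sqrt{q\overline q}$. A quaternionic Hilbert space $\mathsf{H}$ is a right $\mathbb{H}$-module, assumed $\neq\{0\}$, with a scalar product $\langle\cdot|\cdot\rangle:\mathsf{H}\times\mathsf{H}\to\mathbb{H}$ that is right $\mathbb{H}$-linear in the second argument, satisfies $\langle u|v\rangle=\overline{\langle v|u\rangle}$ and $\langle u|u\rangle\ge 0$ with $\langle u|u\rangle=0$ only for $u=0$, and is complete for the norm $\|u\|=\sqrt{\langle u|u\rangle}$. Operators are right $\mathbb{H}$-linear maps; $\mathfrak{B}(\mathsf{H})$ is the set of everywhere defined bounded operators. $T^*$ is the adjoint: $\langle T^*u|v\rangle=\langle u|Tv\rangle$. For $r\in\mathbb{R}$, $Tr$ is the operator $u\mapsto T(u)r$. $T\in\mathfrak{B}(\mathsf{H})$ is normal if $TT^*=T^*T$, self-adjoint if $T^*=T$, anti self-adjoint if $T^*=-T$, unitary if $TT^*=T^*T=\mathrm{I}$ (identity), positive if $\langle u|Tu\rangle\in[0,+\infty)$ for every $u$. For a positive $S\in\mathfrak{B}(\mathsf{H})$, $\sqrt S$ is the unique positive operator in $\mathfrak{B}(\mathsf{H})$ with $\sqrt S\sqrt S=S$, and $|T|:=\sqrt{T^*T}$. For $X\subset\mathsf{H}$, $X^\perp=\{v:\langle v|u\rangle=0\ \forall u\in X\}$. *)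

theory Defs
  imports "HOL-Analysis.Analysis" "HOL-Library.Nonpos_Ints"
begin

section \<open>The quaternions\<close>

text \<open>\<open>Quat a b c d\<close> is \<open>a + b i + c j + d k\<close>.\<close>

datatype quat = Quat (qRe: real) (qI: real) (qJ: real) (qK: real)

lemma quat_eq_iff: "x = y \<longleftrightarrow> qRe x = qRe y \<and> qI x = qI y \<and> qJ x = qJ y \<and> qK x = qK y"
  by (metis quat.expand)

instantiation quat :: ab_group_add
begin

definition "0 = Quat 0 0 0 0"
definition "x + y = Quat (qRe x + qRe y) (qI x + qI y) (qJ x + qJ y) (qK x + qK y)"
definition "- x = Quat (- qRe x) (- qI x) (- qJ x) (- qK x)"
definition "x - y = Quat (qRe x - qRe y) (qI x - qI y) (qJ x - qJ y) (qK x - qK y)"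

instance
  by standard (simp_all add: zero_quat_def plus_quat_def uminus_quat_def minus_quat_def quat_eq_iff)

end

lemma quat_zero_sel [simp]: "qRe 0 = 0" "qI 0 = 0" "qJ 0 = 0" "qK 0 = 0"
  by (simp_all add: zero_quat_def)

lemma quat_plus_sel [simp]:
  "qRe (x + y) = qRe x + qRe y" "qI (x + y) = qI x + qI y"
  "qJ (x + y) = qJ x + qJ y" "qK (x + y) = qK x + qK y"
  by (simp_all add: plus_quat_def)

lemma quat_uminus_sel [simp]:
  "qRe (- x) = - qRe x" "qI (- x) = - qI x" "qJ (- x) = - qJ x" "qK (- x) = - qK x"
  by (simp_all add: uminus_quat_def)

lemma quat_minus_sel [simp]:
  "qRe (x - y) = qRe x - qRe y" "qI (x - y) = qI x - qI y"
  "qJ (x - y) = qJ x - qJ y" "qK (x - y) = qK x - qK y"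
  by (simp_all add: minus_quat_def)

definition qcnj :: "quat \<Rightarrow> quat"
  where "qcnj x = Quat (qRe x) (- qI x) (- qJ x) (- qK x)"

lemma qcnj_sel [simp]:
  "qRe (qcnj x) = qRe x" "qI (qcnj x) = - qI x" "qJ (qcnj x) = - qJ x" "qK (qcnj x) = - qK x"
  by (simp_all add: qcnj_def)

instantiation quat :: ring_1
begin

definition "1 = Quat 1 0 0 0"
definition "x * y = Quat
  (qRe x * qRe y - qI x * qI y - qJ x * qJ y - qK x * qK y)
  (qRe x * qI y + qI x * qRe y + qJ x * qK y - qK x * qJ y)
  (qRe x * qJ y - qI x * qK y + qJ x * qRe y + qK x * qI y)
  (qRe x * qK y + qI x * qJ y - qJ x * qI y + qK x * qRe y)"

instance
  by standard (simp_all add: one_quat_def times_quat_def quat_eq_iff algebra_simps)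

end

lemma quat_one_sel [simp]: "qRe 1 = 1" "qI 1 = 0" "qJ 1 = 0" "qK 1 = 0"
  by (simp_all add: one_quat_def)

lemma quat_times_sel [simp]:
  "qRe (x * y) = qRe x * qRe y - qI x * qI y - qJ x * qJ y - qK x * qK y"
  "qI (x * y) = qRe x * qI y + qI x * qRe y + qJ x * qK y - qK x * qJ y"
  "qJ (x * y) = qRe x * qJ y - qI x * qK y + qJ x * qRe y + qK x * qI y"
  "qK (x * y) = qRe x * qK y + qI x * qJ y - qJ x * qI y + qK x * qRe y"
  by (simp_all add: times_quat_def)

instantiation quat :: real_algebra_1
begin

definition "r *\<^sub>R x = Quat (r * qRe x) (r * qI x) (r * qJ x) (r * qK x)"

instance
  by standard (simp_all add: scaleR_quat_def quat_eq_iff algebra_simps)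

end

lemma quat_scaleR_sel [simp]:
  "qRe (r *\<^sub>R x) = r * qRe x" "qI (r *\<^sub>R x) = r * qI x"
  "qJ (r *\<^sub>R x) = r * qJ x" "qK (r *\<^sub>R x) = r * qK x"
  by (simp_all add: scaleR_quat_def)

lemma quat_of_real_sel [simp]:
  "qRe (of_real r) = r" "qI (of_real r) = 0" "qJ (of_real r) = 0" "qK (of_real r) = 0"
  by (simp_all add: of_real_def)

lemma quat_sumsq_eq_0_iff:
  "(qRe x)\<^sup>2 + (qI x)\<^sup>2 + (qJ x)\<^sup>2 + (qK x)\<^sup>2 = 0 \<longleftrightarrow> x = 0"
  by (auto simp: quat_eq_iff add_nonneg_eq_0_iff)

lemma quat_mult_qcnj:
  "x * qcnj x = of_real ((qRe x)\<^sup>2 + (qI x)\<^sup>2 + (qJ x)\<^sup>2 + (qK x)\<^sup>2)"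
  "qcnj x * x = of_real ((qRe x)\<^sup>2 + (qI x)\<^sup>2 + (qJ x)\<^sup>2 + (qK x)\<^sup>2)"
  by (simp_all add: quat_eq_iff power2_eq_square algebra_simps)

instantiation quat :: real_div_algebra
begin

definition
  "inverse x = qcnj x /\<^sub>R ((qRe x)\<^sup>2 + (qI x)\<^sup>2 + (qJ x)\<^sup>2 + (qK x)\<^sup>2)"
definition "x div (y :: quat) = x * inverse y"

instance
proof
  fix x y :: quat
  show "inverse x * x = 1" if "x \<noteq> 0"
    using that quat_sumsq_eq_0_iff[of x]
    by (simp add: inverse_quat_def quat_mult_qcnj del: of_real_add of_real_power)
      (simp add: of_real_def)
  show "x * inverse x = 1" if "x \<noteq> 0"
    using that quat_sumsq_eq_0_iff[of x]
    by (simp add: inverse_quat_def quat_mult_qcnj del: of_real_add of_real_power)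
      (simp add: of_real_def)
  show "x div y = x * inverse y"
    by (rule divide_quat_def)
  show "inverse (0 :: quat) = 0"
    by (simp add: inverse_quat_def quat_eq_iff)
qed

end

instantiation quat :: real_normed_div_algebra
begin

definition "norm x = sqrt ((qRe x)\<^sup>2 + (qI x)\<^sup>2 + (qJ x)\<^sup>2 + (qK x)\<^sup>2)"
definition "sgn x = x /\<^sub>R norm (x :: quat)"
definition "dist x y = norm (x - y :: quat)"
definition [code del]:
  "(uniformity :: (quat \<times> quat) filter) = (INF e\<in>{0 <..}. principal {(x, y). dist x y < e})"
definition [code del]:
  "open (U :: quat set) \<longleftrightarrow> (\<forall>x\<in>U. eventually (\<lambda>(x', y). x' = x \<longrightarrow> y \<in> U) uniformity)"

instance
proof
  fix r :: real and x y :: quat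
  have norm_eq: "norm z = norm ((qRe z, qI z), (qJ z, qK z))" for z :: quat
    by (simp add: norm_quat_def norm_prod_def)
  show "norm x = 0 \<longleftrightarrow> x = 0"
    by (simp add: norm_quat_def quat_sumsq_eq_0_iff)
  show "norm (x + y) \<le> norm x + norm y"
    using norm_triangle_ineq[of "((qRe x, qI x), (qJ x, qK x))" "((qRe y, qI y), (qJ y, qK y))"]
    by (simp add: norm_eq)
  show "norm (r *\<^sub>R x) = \<bar>r\<bar> * norm x"
    using norm_scaleR[of r "((qRe x, qI x), (qJ x, qK x))"] by (simp add: norm_eq)
  show "norm (x * y) = norm x * norm y"
    by (simp add: norm_quat_def real_sqrt_mult[symmetric] power2_eq_square algebra_simps)
qed (rule sgn_quat_def dist_quat_def uniformity_quat_def open_quat_def)+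

end

section \<open>Quaternionic Hilbert spaces\<close>

text \<open>The real scalar multiplication is the restriction of the right quaternionic one.\<close>

class quat_vector = scaleR + ab_group_add +
  fixes scaleQ :: "'a \<Rightarrow> quat \<Rightarrow> 'a"  (infixl \<open>*\<^sub>Q\<close> 75)
  assumes scaleQ_add_left: "(u + v) *\<^sub>Q q = u *\<^sub>Q q + v *\<^sub>Q q"
    and scaleQ_add_right: "u *\<^sub>Q (p + q) = u *\<^sub>Q p + u *\<^sub>Q q"
    and scaleQ_scaleQ: "(u *\<^sub>Q p) *\<^sub>Q q = u *\<^sub>Q (p * q)"
    and scaleQ_one: "u *\<^sub>Q 1 = u"
    and scaleR_scaleQ: "r *\<^sub>R u = u *\<^sub>Q of_real r"
begin

subclass real_vector
  by standard
    (simp_all add: scaleR_scaleQ scaleQ_add_left scaleQ_add_right scaleQ_scaleQ scaleQ_one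
      mult.commute flip: of_real_mult)

end

text \<open>
  In the next class the real normed vector space axioms follow from the remaining ones (the triangle
  inequality by Cauchy--Schwarz); they are included so that the norm, the metric and the topology
  are those of the library. The last axiom fixes the norm, hence the metric and the topology.
\<close>

class quat_inner = quat_vector + real_normed_vector +
  fixes qinner :: "'a \<Rightarrow> 'a \<Rightarrow> quat"
  assumes qinner_add_right: "qinner u (v + w) = qinner u v + qinner u w"
    and qinner_scaleQ_right: "qinner u (v *\<^sub>Q q) = qinner u v * q"
    and qinner_qcnj: "qinner u v = qcnj (qinner v u)"
    and qinner_self_nonneg: "qinner u u \<in> \<real>\<^sub>\<ge>\<^sub>0"
    and qinner_self_eq_0: "qinner u u = 0 \<Longrightarrow> u = 0"
    and norm_eq_sqrt_qinner: "norm u = sqrt (qRe (qinner u u))"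

class quat_hilbert_space = quat_inner + complete_space +
  assumes ex_nonzero: "\<exists>u. u \<noteq> 0"
begin

subclass banach ..

end

section \<open>Bounded right linear operators\<close>

text \<open>
  The bounded operators of a quaternionic Hilbert space \<open>'h\<close> are the elements of
  \<open>qbounded_ops\<close>. They are represented as bounded real-linear maps, so that sums, compositions
  and operator norms come from that type; by \<open>scaleR_scaleQ\<close>, \<open>r *\<^sub>R T\<close> is the operator
  sending \<open>u\<close> to \<open>T u *\<^sub>Q of_real r\<close>.
\<close>

definition qbounded_ops :: "('h::quat_hilbert_space \<Rightarrow>\<^sub>L 'h) set"
  where "qbounded_ops = {T. \<forall>u q. blinfun_apply T (u *\<^sub>Q q) = blinfun_apply T u *\<^sub>Q q}"

definition qadj :: "('h::quat_hilbert_space \<Rightarrow>\<^sub>L 'h) \<Rightarrow> 'h \<Rightarrow>\<^sub>L 'h"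
  where "qadj T = (THE S. S \<in> qbounded_ops \<and> (\<forall>u v. qinner (S u) v = qinner u (T v)))"

definition qnormal :: "('h::quat_hilbert_space \<Rightarrow>\<^sub>L 'h) \<Rightarrow> bool"
  where "qnormal T \<longleftrightarrow> T o\<^sub>L qadj T = qadj T o\<^sub>L T"

definition qself_adjoint :: "('h::quat_hilbert_space \<Rightarrow>\<^sub>L 'h) \<Rightarrow> bool"
  where "qself_adjoint T \<longleftrightarrow> qadj T = T"

definition qanti_self_adjoint :: "('h::quat_hilbert_space \<Rightarrow>\<^sub>L 'h) \<Rightarrow> bool"
  where "qanti_self_adjoint T \<longleftrightarrow> qadj T = - T"

definition qunitary :: "('h::quat_hilbert_space \<Rightarrow>\<^sub>L 'h) \<Rightarrow> bool"
  where "qunitary T \<longleftrightarrow> T o\<^sub>L qadj T = id_blinfun \<and> qadj T o\<^sub>L T = id_blinfun"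

definition qpositive :: "('h::quat_hilbert_space \<Rightarrow>\<^sub>L 'h) \<Rightarrow> bool"
  where "qpositive T \<longleftrightarrow> (\<forall>u. qinner u (T u) \<in> \<real>\<^sub>\<ge>\<^sub>0)"

definition qsqrt :: "('h::quat_hilbert_space \<Rightarrow>\<^sub>L 'h) \<Rightarrow> 'h \<Rightarrow>\<^sub>L 'h"
  where "qsqrt S = (THE R. R \<in> qbounded_ops \<and> qpositive R \<and> R o\<^sub>L R = S)"

definition qabs :: "('h::quat_hilbert_space \<Rightarrow>\<^sub>L 'h) \<Rightarrow> 'h \<Rightarrow>\<^sub>L 'h"
  where "qabs T = qsqrt (qadj T o\<^sub>L T)"

definition qkernel :: "('h::quat_hilbert_space \<Rightarrow>\<^sub>L 'h) \<Rightarrow> 'h set"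
  where "qkernel T = {u. T u = 0}"

definition qorth_comp :: "'h::quat_hilbert_space set \<Rightarrow> 'h set"
  where "qorth_comp X = {v. \<forall>u\<in>X. qinner v u = 0}"

definition op_commute :: "('h::quat_hilbert_space \<Rightarrow>\<^sub>L 'h) \<Rightarrow> ('h \<Rightarrow>\<^sub>L 'h) \<Rightarrow> bool"
  where "op_commute S T \<longleftrightarrow> S o\<^sub>L T = T o\<^sub>L S"

definition AJB_decomposition ::
  "('h::quat_hilbert_space \<Rightarrow>\<^sub>L 'h) \<Rightarrow> ('h \<Rightarrow>\<^sub>L 'h) \<Rightarrow> ('h \<Rightarrow>\<^sub>L 'h) \<Rightarrow> ('h \<Rightarrow>\<^sub>L 'h) \<Rightarrow> bool"
  where "AJB_decomposition T A B J \<longleftrightarrow>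
    A \<in> qbounded_ops \<and> B \<in> qbounded_ops \<and> J \<in> qbounded_ops \<and>
    T = A + (J o\<^sub>L B) \<and>
    qself_adjoint A \<and> qpositive B \<and>
    qanti_self_adjoint J \<and> qunitary J \<and>
    op_commute A B \<and> op_commute A J \<and> op_commute B J"

end

theory Submission
  imports Defs
begin

text \<open>
  Put \<open>A = (T + T*) / 2\<close>, \<open>C = (T - T*) / 2\<close> and \<open>B = |C|\<close>. The operator \<open>J\<close> is built on the whole
  space at once, without polar decomposition or spectral theory. Consider the real subspaces \<open>M\<close> that
  are invariant under the self-adjoint part of the bicommutant of \<open>T\<close> and \<open>T*\<close>, on which the inner
  product is real, and on which \<open>C m = (B m) i\<close>. By Zorn's lemma there is a maximal one; it is closed
  and no nonzero vector is orthogonal to it, for such a vector yields an orthogonal \<open>w\<close> with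
  \<open>C w = (B w) i\<close>, whose orbit could be added to \<open>M\<close>. So the space is
  \<open>M \<oplus> M i \<oplus> M j \<oplus> M k\<close>, and \<open>J (m q) = m (i q)\<close> defines an anti self-adjoint unitary that
  commutes with \<open>A\<close> and \<open>B\<close> and satisfies \<open>J B = C\<close>.

  Conversely, \<open>T* = A - J B\<close> in every decomposition, which gives \<open>A\<close>, and
  \<open>(T - T*)* (T - T*) = 4 B\<^sup>2\<close>, which gives \<open>B\<close> as square roots are unique. If \<open>J\<close> and \<open>J'\<close> both
  belong to \<open>A\<close> and \<open>B\<close>, then the range of \<open>J - J'\<close> lies in the kernel of \<open>T - T*\<close>.
\<close>

section \<open>Quaternion arithmetic, Cauchy-Schwarz and Riesz representation\<close>

section \<open>Inner product and norm\<close>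

lemma qcnj_mult: "qcnj (x * y) = qcnj y * qcnj x"
  by (simp add: quat_eq_iff algebra_simps)

lemma qcnj_add: "qcnj (x + y) = qcnj x + qcnj y"
  by (simp add: quat_eq_iff)

lemma norm_qcnj [simp]: "norm (qcnj x) = norm x"
  by (simp add: norm_quat_def)

lemma quat_Reals_iff: "x \<in> \<real> \<longleftrightarrow> qI x = 0 \<and> qJ x = 0 \<and> qK x = 0"
proof
  assume "qI x = 0 \<and> qJ x = 0 \<and> qK x = 0"
  then have "x = of_real (qRe x)" by (simp add: quat_eq_iff)
  then show "x \<in> \<real>" by (metis Reals_of_real)
qed (auto elim: Reals_cases)

lemma quat_nonneg_Reals_iff: "x \<in> \<real>\<^sub>\<ge>\<^sub>0 \<longleftrightarrow> x \<in> \<real> \<and> 0 \<le> qRe x"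
  by (auto simp: nonneg_Reals_def elim!: Reals_cases)

lemma quat_Reals_commute: "x \<in> \<real> \<Longrightarrow> x * q = q * x" for q :: quat
  by (auto simp: quat_Reals_iff quat_eq_iff)

text \<open>The real parts of the products with 1, i, j, k are the four coefficients up to sign.
  This lifts identities between real parts to quaternionic ones.\<close>

lemma quat_eqI_qRe_mult:
  assumes "\<And>q. qRe (x * q) = qRe (y * q)"
  shows "x = y"
  using assms[of 1] assms[of "Quat 0 1 0 0"] assms[of "Quat 0 0 1 0"] assms[of "Quat 0 0 0 1"]
  by (simp add: quat_eq_iff)

lemma bounded_linear_qRe: "bounded_linear qRe"
proof (rule bounded_linear_intro[where K = 1])
  fix x show "norm (qRe x) \<le> norm x * 1"
    unfolding norm_quat_def by (simp add: real_le_rsqrt)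
qed simp_all

lemma qinner_add_left: "qinner (u + v) w = qinner u w + qinner v (w::'a::quat_inner)"
  by (metis qinner_add_right qinner_qcnj qcnj_add)

lemma qinner_scaleQ_left: "qinner (u *\<^sub>Q q) (v::'a::quat_inner) = qcnj q * qinner u v"
  by (metis qinner_scaleQ_right qinner_qcnj qcnj_mult)

lemma qinner_scaleR_right: "qinner u (r *\<^sub>R v) = r *\<^sub>R qinner u (v::'a::quat_inner)"
  by (simp add: scaleR_scaleQ qinner_scaleQ_right quat_eq_iff)

lemma qinner_scaleR_left: "qinner (r *\<^sub>R u) v = r *\<^sub>R qinner u (v::'a::quat_inner)"
  by (simp add: scaleR_scaleQ qinner_scaleQ_left quat_eq_iff)

lemma qRe_qinner_self: "qRe (qinner u u) = (norm (u::'a::quat_inner))\<^sup>2"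
  using qinner_self_nonneg[of u] by (simp add: norm_eq_sqrt_qinner quat_nonneg_Reals_iff)

lemma qinner_self: "qinner u u = of_real ((norm (u::'a::quat_inner))\<^sup>2)"
  using qinner_self_nonneg[of u] qRe_qinner_self[of u]
  by (simp add: quat_nonneg_Reals_iff quat_Reals_iff quat_eq_iff del: of_real_power)

lemma qRe_qinner_commute: "qRe (qinner u v) = qRe (qinner v (u::'a::quat_inner))"
  by (metis qinner_qcnj qcnj_sel(1))

lemma norm_scaleQ: "norm (u *\<^sub>Q q) = norm (u::'a::quat_inner) * norm q"
proof -
  have "(norm (u *\<^sub>Q q))\<^sup>2 = qRe (qcnj q * qinner u u * q)"
    using qRe_qinner_self[of "u *\<^sub>Q q"]
    by (simp only: qinner_scaleQ_left qinner_scaleQ_right mult.assoc)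
  also have "\<dots> = qRe (qcnj q * of_real ((norm u)\<^sup>2) * q)"
    by (simp only: qinner_self)
  also have "\<dots> = (norm u * norm q)\<^sup>2"
    by (simp add: norm_quat_def power_mult_distrib algebra_simps del: of_real_power)
      (simp add: power2_eq_square algebra_simps)
  finally show ?thesis by simp
qed

lemma bounded_linear_scaleQ: "bounded_linear (\<lambda>u::'a::quat_inner. u *\<^sub>Q q)"
proof (rule bounded_linear_intro[where K = "norm q"])
  show "(r *\<^sub>R u) *\<^sub>Q q = r *\<^sub>R (u *\<^sub>Q q)" for r and u :: 'a
    by (simp add: scaleR_scaleQ scaleQ_scaleQ quat_Reals_commute)
qed (simp_all add: scaleQ_add_left norm_scaleQ)

text \<open>The triangle inequality is an axiom of the class, so Cauchy-Schwarz is read off from it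
  by expanding the square of \<open>norm (u + v)\<close>.\<close>

lemma qRe_qinner_le: "qRe (qinner u v) \<le> norm u * norm (v::'a::quat_inner)"
proof -
  have "(norm (u + v))\<^sup>2 = (norm u)\<^sup>2 + (norm v)\<^sup>2 + 2 * qRe (qinner u v)"
    using qRe_qinner_commute[of u v]
    by (simp add: qRe_qinner_self[symmetric] qinner_add_left qinner_add_right)
  moreover have "(norm (u + v))\<^sup>2 \<le> (norm u + norm v)\<^sup>2"
    by (intro power_mono norm_triangle_ineq) auto
  ultimately show ?thesis by (simp add: power2_sum)
qed

text \<open>Multiplying \<open>v\<close> by the conjugate of the inner product turns the real part
  into the squared norm, which reduces the bound to the one for real parts.\<close>

lemma norm_qinner_le: "norm (qinner u v) \<le> norm u * norm (v::'a::quat_inner)"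
proof (cases "qinner u v = 0")
  case False
  have "(norm (qinner u v))\<^sup>2 = qRe (qinner u (v *\<^sub>Q qcnj (qinner u v)))"
    by (simp add: qinner_scaleQ_right norm_quat_def power2_eq_square)
  also have "\<dots> \<le> norm u * norm v * norm (qinner u v)"
    using qRe_qinner_le[of u "v *\<^sub>Q qcnj (qinner u v)"] by (simp add: norm_scaleQ)
  finally show ?thesis using False by (simp add: power2_eq_square)
qed simp

lemma bounded_bilinear_qinner: "bounded_bilinear (qinner :: 'a::quat_inner \<Rightarrow> 'a \<Rightarrow> quat)"
  by unfold_locales
    (auto simp: qinner_add_left qinner_add_right qinner_scaleR_left qinner_scaleR_right
      intro!: exI[of _ 1] norm_qinner_le)

lemmas scaleQ_diff_left = linear_diff[OF bounded_linear.linear[OF bounded_linear_scaleQ]]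
lemma scaleQ_minus_right: "u *\<^sub>Q (- q) = - (u *\<^sub>Q q :: 'a::quat_vector)"
  using scaleQ_add_right[of u q "- q"] scaleQ_add_right[of u 0 0] by (simp add: add_eq_0_iff)

lemmas scaleQ_zero_left = linear_0[OF bounded_linear.linear[OF bounded_linear_scaleQ]]
lemmas scaleQ_minus_left = linear_neg[OF bounded_linear.linear[OF bounded_linear_scaleQ]]
lemmas qinner_diff_left = bounded_bilinear.diff_left[OF bounded_bilinear_qinner]
lemmas qinner_diff_right = bounded_bilinear.diff_right[OF bounded_bilinear_qinner]
lemmas qinner_minus_left = bounded_bilinear.minus_left[OF bounded_bilinear_qinner]
lemmas qinner_minus_right = bounded_bilinear.minus_right[OF bounded_bilinear_qinner]
lemmas qinner_zero_left = bounded_bilinear.zero_left[OF bounded_bilinear_qinner]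
lemmas qinner_zero_right = bounded_bilinear.zero_right[OF bounded_bilinear_qinner]
lemmas continuous_on_qinner [continuous_intros] =
  bounded_bilinear.continuous_on[OF bounded_bilinear_qinner]
lemmas continuous_on_scaleQ [continuous_intros] =
  bounded_linear.continuous_on[OF bounded_linear_scaleQ]
lemmas qinner_simps = qinner_add_left qinner_add_right qinner_diff_left qinner_diff_right
  qinner_minus_left qinner_minus_right qinner_zero_left qinner_zero_right
  qinner_scaleR_left qinner_scaleR_right

lemma qinner_eq_cancel_right:
  assumes "\<And>v. qinner v x = qinner v y"
  shows "x = (y::'a::quat_inner)"
proof -
  have "qinner (x - y) (x - y) = 0" using assms by (simp add: qinner_simps)
  then show ?thesis using qinner_self_eq_0 by fastforce
qed

lemma qinner_eq_cancel_left:
  assumes "\<And>v. qinner x v = qinner y v"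
  shows "x = (y::'a::quat_inner)"
  using assms by (metis qinner_eq_cancel_right qinner_qcnj)

text \<open>A minimiser of \<open>F v = |v|^2 - 2 f v\<close> on \<open>M\<close> represents
  \<open>f\<close> there. With \<open>M\<close> the whole space this yields adjoints; with
  \<open>f\<close> an inner product it yields orthogonal projections onto closed real
  subspaces.\<close>

lemma riesz_closed_subspace:
  fixes f :: "'a::{quat_inner, complete_space} \<Rightarrow> real"
  assumes M: "subspace M" "closed M" and f: "bounded_linear f"
  shows "\<exists>w\<in>M. \<forall>v\<in>M. qRe (qinner w v) = f v"
proof -
  interpret f: bounded_linear f by fact
  define F where "F v = (norm v)\<^sup>2 - 2 * f v" for v
  define d where "d = (INF v\<in>M. F v)"
  have M0: "M \<noteq> {}" using subspace_0[OF M(1)] by auto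
  obtain K where K: "\<And>v. norm (f v) \<le> norm v * K" using f.bounded by blast
  have "- K\<^sup>2 \<le> F v" for v
  proof -
    have "0 \<le> (norm v - K)\<^sup>2" by simp
    also have "\<dots> \<le> F v + K\<^sup>2" using K[of v] by (simp add: F_def power2_diff)
    finally show ?thesis by simp
  qed
  then have bdd: "bdd_below (F ` M)" by (intro bdd_belowI2)
  then have d_le: "d \<le> F v" if "v \<in> M" for v
    unfolding d_def using that by (rule cINF_lower)
  have "\<exists>v\<in>M. F v < d + 1 / Suc n" for n
    using cInf_lessD[of "F ` M" "d + 1 / Suc n"] M0 by (auto simp: d_def)
  then obtain V where V: "\<And>n. V n \<in> M" "\<And>n. F (V n) < d + 1 / Suc n" by metis
  \<comment> \<open>Parallelogram law: the linear parts of \<open>F\<close> cancel, and the midpoint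
    lies in \<open>M\<close>, where \<open>F\<close> is at least \<open>d\<close>. Hence minimising
    sequences are Cauchy.\<close>
  have near: "(norm (x - y))\<^sup>2 \<le> 2 * (F x - d) + 2 * (F y - d)" if "x \<in> M" "y \<in> M" for x y
  proof -
    have "(1/2) *\<^sub>R (x + y) \<in> M" using that M(1) by (simp add: subspace_add subspace_scale)
    moreover have "(norm (x - y))\<^sup>2 = 2 * F x + 2 * F y - 4 * F ((1/2) *\<^sub>R (x + y))"
      using qRe_qinner_commute[of x y]
      by (simp add: F_def f.scaleR f.add qRe_qinner_self[symmetric] qinner_simps algebra_simps)
    ultimately show ?thesis using d_le by fastforce
  qed
  have "Cauchy V"
  proof (rule CauchyI)
    fix e :: real assume "0 < e"
    then obtain N :: nat where N: "1 / Suc N < e\<^sup>2 / 4"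
      by (meson divide_pos_pos nat_approx_posE zero_less_numeral zero_less_power)
    have small: "F (V m) < d + e\<^sup>2 / 4" if "m \<ge> N" for m
    proof -
      note V(2)[of m]
      also have "d + 1 / Suc m \<le> d + 1 / Suc N" using that by (simp add: field_simps)
      also have "\<dots> < d + e\<^sup>2 / 4" using N by simp
      finally show ?thesis .
    qed
    have "norm (V m - V n) < e" if "m \<ge> N" "n \<ge> N" for m n
    proof -
      have "(norm (V m - V n))\<^sup>2 < e\<^sup>2"
        using near[OF V(1) V(1), of m n] small[OF that(1)] small[OF that(2)]
        by (simp add: field_simps)
      then show ?thesis using \<open>0 < e\<close> by (simp add: power_less_imp_less_base)
    qed
    then show "\<exists>N. \<forall>m\<ge>N. \<forall>n\<ge>N. norm (V m - V n) < e" by blast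
  qed
  then obtain w where w: "V \<longlonglongrightarrow> w" using Cauchy_convergent_iff convergent_def by blast
  have wM: "w \<in> M" using M(2) V(1) w by (auto intro: closed_sequentially)
  have "(\<lambda>n. F (V n)) \<longlonglongrightarrow> F w" unfolding F_def by (intro tendsto_intros f.tendsto w)
  moreover have "(\<lambda>n. d + 1 / Suc n) \<longlonglongrightarrow> d + 0"
    using LIMSEQ_inverse_real_of_nat by (intro tendsto_intros) (simp add: inverse_eq_divide)
  ultimately have "F w \<le> d + 0"
    by (rule LIMSEQ_le) (use V(2) less_imp_le in blast)
  then have Fw: "F w \<le> d" by simp
  have "qRe (qinner w v) = f v" if v: "v \<in> M" for v
  proof (rule ccontr)
    assume ne: "qRe (qinner w v) \<noteq> f v"
    define g where "g = qRe (qinner w v) - f v"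
    have nv: "norm v \<noteq> 0"
      using ne f.zero by (auto simp: qinner_simps)
    \<comment> \<open>The minimiser of \<open>t^2 |v|^2 + 2 t g\<close>: with \<open>g\<close>
      nonzero, moving from \<open>w\<close> along \<open>v\<close> by this amount would push
      \<open>F\<close> below its infimum.\<close>
    define t where "t = - g / (norm v)\<^sup>2"
    have "(norm (w + t *\<^sub>R v))\<^sup>2 = (norm w)\<^sup>2 + t\<^sup>2 * (norm v)\<^sup>2 + 2 * t * qRe (qinner w v)"
      unfolding qRe_qinner_self[symmetric] using qRe_qinner_commute[of w v]
      by (simp add: qinner_simps power2_eq_square algebra_simps)
    then have "F (w + t *\<^sub>R v) = F w + t\<^sup>2 * (norm v)\<^sup>2 + 2 * t * g"
      by (simp add: F_def g_def f.scaleR f.add algebra_simps)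
    also have "\<dots> = F w - g\<^sup>2 / (norm v)\<^sup>2"
      using nv by (simp add: t_def field_simps power2_eq_square)
    also have "\<dots> < F w" using nv ne by (simp add: g_def)
    also have "F w \<le> F (w + t *\<^sub>R v)"
      using Fw d_le[of "w + t *\<^sub>R v"] M(1) v wM by (simp add: subspace_add subspace_scale)
    finally show False by simp
  qed
  then show ?thesis using wM by blast
qed

section \<open>Existence of adjoints; symmetry and null vectors of positive operators\<close>

section \<open>Adjoints and positive operators\<close>

lemma qbounded_opsD: "T \<in> qbounded_ops \<Longrightarrow> T (u *\<^sub>Q q) = T u *\<^sub>Q q"
  by (simp add: qbounded_ops_def)

lemma qbounded_ops_compose: "S \<in> qbounded_ops \<Longrightarrow> T \<in> qbounded_ops \<Longrightarrow> S o\<^sub>L T \<in> qbounded_ops"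
  by (simp add: qbounded_ops_def)

lemma qbounded_ops_add: "S \<in> qbounded_ops \<Longrightarrow> T \<in> qbounded_ops \<Longrightarrow> S + T \<in> qbounded_ops"
  by (simp add: qbounded_ops_def blinfun.bilinear_simps scaleQ_add_left)

lemma qbounded_ops_diff: "S \<in> qbounded_ops \<Longrightarrow> T \<in> qbounded_ops \<Longrightarrow> S - T \<in> qbounded_ops"
  by (simp add: qbounded_ops_def blinfun.bilinear_simps scaleQ_diff_left)

lemma qbounded_ops_scaleR: "T \<in> qbounded_ops \<Longrightarrow> r *\<^sub>R T \<in> qbounded_ops"
  by (simp add: qbounded_ops_def blinfun.bilinear_simps
      linear_scale[OF bounded_linear.linear[OF bounded_linear_scaleQ]])

lemma qbounded_ops_minus: "T \<in> qbounded_ops \<Longrightarrow> - T \<in> qbounded_ops"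
  by (simp add: qbounded_ops_def blinfun.bilinear_simps scaleQ_minus_left)

lemma qbounded_ops_zero: "0 \<in> qbounded_ops"
  by (simp add: qbounded_ops_def scaleQ_zero_left)

lemma qbounded_ops_id: "id_blinfun \<in> qbounded_ops"
  by (simp add: qbounded_ops_def)

lemma qadj_unique:
  fixes S T :: "'h::quat_hilbert_space \<Rightarrow>\<^sub>L 'h"
  assumes "S \<in> qbounded_ops" "\<And>u v. qinner (S u) v = qinner u (T v)"
  shows "qadj T = S"
  unfolding qadj_def
proof (rule the_equality)
  show "S' = S" if "S' \<in> qbounded_ops \<and> (\<forall>u v. qinner (S' u) v = qinner u (T v))" for S'
    using that assms(2) by (intro blinfun_eqI qinner_eq_cancel_left) simp
qed (use assms in simp)

text \<open>Riesz is applied to the real part of the inner product only; right linearity of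
  \<open>T\<close>, tested on \<open>v *\<^sub>Q q\<close>, recovers the full quaternionic
  identity.\<close>

lemma ex_adjoint:
  fixes T :: "'h::quat_hilbert_space \<Rightarrow>\<^sub>L 'h"
  assumes T: "T \<in> qbounded_ops"
  shows "\<exists>S\<in>qbounded_ops. \<forall>u v. qinner (blinfun_apply S u) v = qinner u (T v)"
proof -
  have "\<exists>w. \<forall>v. qRe (qinner w v) = qRe (qinner u (T v))" for u
  proof -
    have "bounded_linear (\<lambda>v. qRe (qinner u (T v)))"
      by (intro bounded_linear_compose[OF bounded_linear_qRe]
          bounded_linear_compose[OF bounded_bilinear.bounded_linear_right[OF bounded_bilinear_qinner]]
          blinfun.bounded_linear_right)
    from riesz_closed_subspace[OF subspace_UNIV closed_UNIV this] show ?thesis by simp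
  qed
  then obtain S where S: "\<And>u v. qRe (qinner (S u) v) = qRe (qinner u (T v))" by metis
  have S': "qinner (S u) v = qinner u (T v)" for u v
  proof (rule quat_eqI_qRe_mult)
    show "qRe (qinner (S u) v * q) = qRe (qinner u (T v) * q)" for q
      using S[of u "v *\<^sub>Q q"] by (simp add: qinner_scaleQ_right qbounded_opsD[OF T])
  qed
  have "bounded_linear S"
  proof (rule bounded_linear_intro[where K = "norm T"])
    show "S (u + v) = S u + S v" for u v
      by (rule qinner_eq_cancel_left) (simp add: S' qinner_simps)
    show "S (r *\<^sub>R u) = r *\<^sub>R S u" for r u
      by (rule qinner_eq_cancel_left) (simp add: S' qinner_simps)
    fix u
    have "(norm (S u))\<^sup>2 = qRe (qinner u (T (S u)))"
      by (simp add: S flip: qRe_qinner_self)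
    also have "\<dots> \<le> norm u * (norm T * norm (S u))"
      by (intro order_trans[OF qRe_qinner_le] mult_left_mono norm_blinfun) simp
    finally have "norm (S u) * norm (S u) \<le> norm u * norm T * norm (S u)"
      by (simp add: power2_eq_square mult.assoc)
    then show "norm (S u) \<le> norm u * norm T"
      by (cases "norm (S u) = 0") (auto intro: mult_right_le_imp_le)
  qed
  moreover have "S (u *\<^sub>Q q) = S u *\<^sub>Q q" for u q
    by (rule qinner_eq_cancel_left) (simp add: S' qinner_scaleQ_left)
  ultimately show ?thesis
    by (intro bexI[of _ "Blinfun S"]) (auto simp: qbounded_ops_def bounded_linear_Blinfun_apply S')
qed

lemma
  fixes T :: "'h::quat_hilbert_space \<Rightarrow>\<^sub>L 'h"
  assumes "T \<in> qbounded_ops"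
  shows qadj_qbounded_ops: "qadj T \<in> qbounded_ops"
    and qinner_qadj_left: "qinner (qadj T u) v = qinner u (T v)"
    and qinner_qadj_right: "qinner u (qadj T v) = qinner (T u) v"
proof -
  obtain S where S: "S \<in> qbounded_ops" "\<And>u v. qinner (blinfun_apply S u) v = qinner u (T v)"
    using ex_adjoint[OF assms] by blast
  then have eq: "qadj T = S" by (rule qadj_unique)
  show "qadj T \<in> qbounded_ops" "qinner (qadj T u) v = qinner u (T v)"
    using S by (simp_all add: eq)
  then show "qinner u (qadj T v) = qinner (T u) v"
    by (metis S(2) eq qinner_qcnj)
qed

lemma qself_adjoint_iff:
  fixes T :: "'h::quat_hilbert_space \<Rightarrow>\<^sub>L 'h"
  assumes "T \<in> qbounded_ops"
  shows "qself_adjoint T \<longleftrightarrow> (\<forall>u v. qinner (T u) v = qinner u (T v))"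
  unfolding qself_adjoint_def using qadj_unique[OF assms] qinner_qadj_left[OF assms] by metis

text \<open>Polarisation: reality of the quadratic form makes the imaginary parts of
  \<open>qinner u (T v)\<close> and \<open>qinner v (T u)\<close> opposite, and replacing
  \<open>v\<close> by its multiples with i and j makes the real parts equal.\<close>

lemma qpositive_symmetric:
  fixes T :: "'h::quat_hilbert_space \<Rightarrow>\<^sub>L 'h"
  assumes T: "T \<in> qbounded_ops" and "qpositive T"
  shows "qinner (T u) v = qinner u (T v)"
proof -
  have real: "qinner x (T x) \<in> \<real>" for x
    using assms(2) by (simp add: qpositive_def quat_nonneg_Reals_iff)
  have sum: "qinner x (T y) + qinner y (T x) \<in> \<real>" for x y
  proof -
    have "qinner x (T y) + qinner y (T x)
        = qinner (x + y) (T (x + y)) - qinner x (T x) - qinner y (T y)"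
      by (simp add: blinfun.bilinear_simps qinner_simps)
    then show ?thesis using real by simp
  qed
  have "qinner u (T v) = qcnj (qinner v (T u))"
    using sum[of u v] sum[of u "v *\<^sub>Q Quat 0 1 0 0"] sum[of u "v *\<^sub>Q Quat 0 0 1 0"]
    by (simp add: qbounded_opsD[OF T] qinner_scaleQ_left qinner_scaleQ_right quat_Reals_iff
        quat_eq_iff)
  then show ?thesis by (metis qinner_qcnj)
qed

text \<open>Along \<open>u + t T u\<close> the form is a nonnegative quadratic polynomial in
  \<open>t\<close> without constant term, so its linear coefficient \<open>2 |T u|^2\<close> must
  vanish.\<close>

lemma qpositive_null:
  fixes T :: "'h::quat_hilbert_space \<Rightarrow>\<^sub>L 'h"
  assumes T: "T \<in> qbounded_ops" "qpositive T" and "qinner u (T u) = 0"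
  shows "T u = 0"
proof (rule ccontr)
  assume ne: "T u \<noteq> 0"
  define a where "a = (norm (T u))\<^sup>2"
  define b where "b = qRe (qinner (T u) (T (T u)))"
  have a: "0 < a" using ne by (simp add: a_def)
  have b: "0 \<le> b" using T(2) by (simp add: b_def qpositive_def quat_nonneg_Reals_iff)
  have "0 \<le> qRe (qinner (u + t *\<^sub>R T u) (T (u + t *\<^sub>R T u)))" for t
    using T(2) by (simp add: qpositive_def quat_nonneg_Reals_iff)
  moreover have "qRe (qinner u (T (T u))) = a"
    using qpositive_symmetric[OF T, of u "T u"] by (simp add: a_def flip: qRe_qinner_self)
  ultimately have "0 \<le> 2 * t * a + t\<^sup>2 * b" for t
    using assms(3) qRe_qinner_self[of "T u"]
    by (simp add: blinfun.bilinear_simps qinner_simps a_def b_def power2_eq_square algebra_simps)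
  \<comment> \<open>The summand 1 keeps the denominator positive when \<open>b\<close> is 0.\<close>
  moreover define t where "t = - a / (b + 1)"
  moreover have "t * (b + 1) = - a" using b by (simp add: t_def)
  then have "2 * t * a + t\<^sup>2 * b = t * a - t\<^sup>2" by (simp add: power2_eq_square) algebra
  moreover have "t * a < 0" using a b by (simp add: t_def)
  ultimately show False by (smt (verit) zero_le_power2)
qed

section \<open>Positive square roots: uniqueness, construction and commutation\<close>

section \<open>Square roots\<close>

text \<open>For commuting roots \<open>(P + R) D = 0\<close> with \<open>D = P - R\<close>. The two
  nonnegative forms at \<open>D u\<close> therefore add up to zero, so \<open>P D = R D = 0\<close>
  and \<open>D^2 = 0\<close>; as \<open>D\<close> is symmetric, it vanishes.\<close>

lemma qpositive_sqrt_unique: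
  fixes P R :: "'h::quat_hilbert_space \<Rightarrow>\<^sub>L 'h"
  assumes P: "P \<in> qbounded_ops" "qpositive P" and R: "R \<in> qbounded_ops" "qpositive R"
    and sq: "P o\<^sub>L P = R o\<^sub>L R" and comm: "P o\<^sub>L R = R o\<^sub>L P"
  shows "R = P"
proof -
  define D where "D = P - R"
  note symP = qpositive_symmetric[OF P] and symR = qpositive_symmetric[OF R]
  have sym: "qinner (D u) v = qinner u (D v)" for u v
    by (simp add: D_def blinfun.bilinear_simps qinner_simps symP symR)
  have sq': "P (P u) = R (R u)" and comm': "P (R u) = R (P u)" for u
    using sq comm by (metis blinfun_apply_blinfun_compose)+
  have "qinner (D u) (P (D u)) + qinner (D u) (R (D u)) = 0" for u
    by (simp add: D_def blinfun.bilinear_simps sq' comm' flip: qinner_add_right)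
      (simp add: qinner_simps)
  moreover have "0 \<le> qRe (qinner (D u) (P (D u)))" "0 \<le> qRe (qinner (D u) (R (D u)))"
    "qinner (D u) (P (D u)) \<in> \<real>" "qinner (D u) (R (D u)) \<in> \<real>" for u
    using P(2) R(2) by (simp_all add: qpositive_def quat_nonneg_Reals_iff)
  ultimately have "qinner (D u) (P (D u)) = 0 \<and> qinner (D u) (R (D u)) = 0" for u
    by (simp add: quat_eq_iff quat_Reals_iff) (smt (verit))
  then have "P (D u) = 0" "R (D u) = 0" for u
    using qpositive_null[OF P] qpositive_null[OF R] by blast+
  then have DD: "D (D u) = 0" for u
    by (simp add: blinfun.bilinear_simps D_def)
  have "D u = 0" for u
    using sym[of u "D u"] DD[of u] by (simp add: qinner_simps qinner_self_eq_0)
  then show ?thesis by (simp add: D_def blinfun.bilinear_simps blinfun_eqI)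
qed

text \<open>The fixed point of \<open>Y \<mapsto> (X + Y\<^sup>2) / 2\<close> is \<open>1 - sqrt (1 - X)\<close>. In norm, the increments of the
  iteration from \<open>0\<close> are dominated by those of the scalar map \<open>y \<mapsto> (1 + y\<^sup>2) / 2\<close>, whose iterates
  increase and are bounded by \<open>1\<close>.\<close>

lemma ex_sqrt_fixpoint:
  fixes X :: "'a::banach \<Rightarrow>\<^sub>L 'a"
  assumes X: "norm X \<le> 1"
  obtains Y where "norm Y \<le> 1" "2 *\<^sub>R Y = X + (Y o\<^sub>L Y)"
    "\<forall>Q. closed Q \<and> 0 \<in> Q \<and> (\<forall>Z\<in>Q. (1/2) *\<^sub>R (X + (Z o\<^sub>L Z)) \<in> Q) \<longrightarrow> Y \<in> Q"
proof -
  define Z where "Z n = ((\<lambda>Z. (1/2) *\<^sub>R (X + (Z o\<^sub>L Z))) ^^ n) 0" for n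
  define z where "z n = ((\<lambda>z::real. (1 + z\<^sup>2) / 2) ^^ n) 0" for n
  have Z_simps: "Z 0 = 0" "Z (Suc n) = (1/2) *\<^sub>R (X + (Z n o\<^sub>L Z n))" for n
    by (simp_all add: Z_def)
  have z_simps: "z 0 = 0" "z (Suc n) = (1 + (z n)\<^sup>2) / 2" for n
    by (simp_all add: z_def)
  have z01: "0 \<le> z n \<and> z n \<le> 1" for n
    by (induction n) (auto simp: z_simps power_le_one)
  have norm_Z: "norm (Z n) \<le> z n" for n
  proof (induction n)
    case (Suc n)
    have "norm (Z n o\<^sub>L Z n) \<le> norm (Z n) * norm (Z n)" by (rule norm_blinfun_compose)
    also have "\<dots> \<le> (z n)\<^sup>2" using Suc by (simp add: power2_eq_square mult_mono')
    finally have "norm (X + (Z n o\<^sub>L Z n)) \<le> 1 + (z n)\<^sup>2" using X by (intro norm_triangle_le) auto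
    then show ?case by (simp add: Z_simps z_simps)
  qed (simp add: Z_simps z_simps)
  have step: "norm (Z (Suc n) - Z n) \<le> z (Suc n) - z n" for n
  proof (induction n)
    case (Suc n)
    let ?D = "Z (Suc n) - Z n"
    \<comment> \<open>Difference of squares without commutativity:
      \<open>Z'^2 - Z^2 = Z' (Z' - Z) + (Z' - Z) Z\<close>.\<close>
    have "Z (Suc (Suc n)) - Z (Suc n) = (1/2) *\<^sub>R ((Z (Suc n) o\<^sub>L ?D) + (?D o\<^sub>L Z n))"
      unfolding Z_simps(2)[of "Suc n"] Z_simps(2)[of n]
      by (rule blinfun_eqI) (simp add: blinfun.bilinear_simps algebra_simps)
    also have "norm \<dots> \<le> (1/2) * (z (Suc n) * (z (Suc n) - z n) + (z (Suc n) - z n) * z n)"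
    proof -
      have "norm (Z (Suc n) o\<^sub>L ?D) \<le> z (Suc n) * (z (Suc n) - z n)"
        by (rule order_trans[OF norm_blinfun_compose]) (intro mult_mono' norm_Z Suc norm_ge_zero)
      moreover have "norm (?D o\<^sub>L Z n) \<le> (z (Suc n) - z n) * z n"
        by (rule order_trans[OF norm_blinfun_compose]) (intro mult_mono' norm_Z Suc norm_ge_zero)
      ultimately show ?thesis by (simp add: norm_triangle_le)
    qed
    also have "\<dots> = z (Suc (Suc n)) - z (Suc n)"
      unfolding z_simps(2)[of "Suc n"] by (subst (3) z_simps(2)) (simp add: power2_eq_square field_simps)
    finally show ?case .
  qed (use X in \<open>simp add: Z_simps z_simps\<close>)
  have mono: "norm (Z (m + k) - Z m) \<le> z (m + k) - z m" for m k
  proof (induction k)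
    case (Suc k)
    have "norm (Z (m + Suc k) - Z m) \<le> norm (Z (Suc (m + k)) - Z (m + k)) + norm (Z (m + k) - Z m)"
      using norm_triangle_ineq[of "Z (Suc (m + k)) - Z (m + k)" "Z (m + k) - Z m"] by simp
    also have "\<dots> \<le> z (m + Suc k) - z m" using Suc step[of "m + k"] by simp
    finally show ?case .
  qed simp
  have "incseq z"
    using step by (intro incseq_SucI) (smt (verit) norm_ge_zero)
  then have "convergent z"
    using z01 by (intro Bseq_monoseq_convergent BseqI'[of _ 1]) (auto simp: monoseq_iff)
  then have "Cauchy z" by (rule convergent_Cauchy)
  have "Cauchy Z"
  proof (rule CauchyI')
    fix e :: real assume "0 < e"
    then obtain M where M: "\<And>m n. m \<ge> M \<Longrightarrow> n \<ge> M \<Longrightarrow> norm (z m - z n) < e"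
      using \<open>Cauchy z\<close> by (metis Cauchy_iff)
    have "dist (Z m) (Z n) < e" if "m \<ge> M" "n > m" for m n
      using mono[of m "n - m"] M[of n m] that by (simp add: dist_norm norm_minus_commute)
    then show "\<exists>M. \<forall>m\<ge>M. \<forall>n>m. dist (Z m) (Z n) < e" by blast
  qed
  then obtain Y where Y: "Z \<longlonglongrightarrow> Y" using Cauchy_convergent_iff convergent_def by blast
  have "norm (Z n) \<le> 1" for n using norm_Z[of n] z01[of n] by linarith
  then have "norm Y \<le> 1" by (intro Lim_bounded[OF tendsto_norm[OF Y]]) auto
  moreover have "2 *\<^sub>R Y = X + (Y o\<^sub>L Y)"
  proof -
    have "(\<lambda>n. (1/2) *\<^sub>R (X + (Z n o\<^sub>L Z n))) \<longlonglongrightarrow> (1/2) *\<^sub>R (X + (Y o\<^sub>L Y))"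
      by (intro tendsto_intros bounded_bilinear.tendsto[OF bounded_bilinear_blinfun_compose] Y)
    then have "(\<lambda>n. Z (Suc n)) \<longlonglongrightarrow> (1/2) *\<^sub>R (X + (Y o\<^sub>L Y))" by (simp add: Z_simps)
    then have "Y = (1/2) *\<^sub>R (X + (Y o\<^sub>L Y))" using LIMSEQ_Suc[OF Y] LIMSEQ_unique by blast
    then show ?thesis by (metis scaleR_half_double scaleR_2 scaleR_right_distrib)
  qed
  \<comment> \<open>An induction principle for \<open>Y\<close>: closed properties preserved by the
    iteration pass to the limit. It is applied to right linearity, symmetry and commutation with a
    given operator.\<close>
  moreover have "Y \<in> Q"
    if Q: "closed Q" "0 \<in> Q" "\<And>Z. Z \<in> Q \<Longrightarrow> (1/2) *\<^sub>R (X + (Z o\<^sub>L Z)) \<in> Q" for Q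
  proof (rule closed_sequentially[OF Q(1) _ Y])
    show "Z n \<in> Q" for n by (induction n) (simp_all only: Z_simps Q)
  qed
  ultimately show ?thesis by (intro that) blast+
qed

lemma closed_qbounded_ops: "closed qbounded_ops"
  unfolding qbounded_ops_def
  by (intro closed_Collect_all closed_Collect_eq continuous_intros) 

lemma blinfun_commute_iff:
  "W o\<^sub>L Z = Z o\<^sub>L W \<longleftrightarrow> (\<forall>u. blinfun_apply W (blinfun_apply Z u) = Z (W u))"
  by (simp add: fun_eq_iff flip: blinfun_apply_inject)

lemma closed_commutant: "closed {Z. W o\<^sub>L Z = Z o\<^sub>L (W :: 'a::real_normed_vector \<Rightarrow>\<^sub>L 'a)}"
  by (intro closed_Collect_eq bounded_bilinear.continuous_on[OF bounded_bilinear_blinfun_compose]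
      continuous_intros)

text \<open>After division by \<open>c^2\<close>, the operator \<open>S = C* C\<close> becomes
  \<open>1 - X\<close> with \<open>X\<close> of norm at most 1, and the root is
  \<open>c (1 - Y)\<close> with \<open>Y\<close> the fixed point for \<open>X\<close>. The clause on
  \<open>W\<close> later gives uniqueness of the root and places \<open>B\<close> in the
  bicommutant.\<close>

lemma ex_qpositive_sqrt:
  fixes C :: "'h::quat_hilbert_space \<Rightarrow>\<^sub>L 'h"
  assumes C: "C \<in> qbounded_ops"
  shows "\<exists>P\<in>qbounded_ops. qpositive P \<and> P o\<^sub>L P = qadj C o\<^sub>L C \<and>
    (\<forall>W. W o\<^sub>L (qadj C o\<^sub>L C) = (qadj C o\<^sub>L C) o\<^sub>L W \<longrightarrow> W o\<^sub>L P = P o\<^sub>L W)"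
proof -
  \<comment> \<open>The added 1 keeps \<open>c\<close> positive when \<open>C\<close> is
    zero.\<close>
  define c where "c = norm C + 1"
  have c: "0 < c" "norm C \<le> c" by (simp_all add: c_def add_pos_nonneg add.commute)
  define S where "S = qadj C o\<^sub>L C"
  define X where "X = id_blinfun - (1 / c\<^sup>2) *\<^sub>R S"
  have S: "S \<in> qbounded_ops" by (simp add: S_def qbounded_ops_compose qadj_qbounded_ops C)
  have symS: "qinner (S u) v = qinner u (S v)" and SC: "qinner u (S v) = qinner (C u) (C v)" for u v
    by (simp_all add: S_def qinner_qadj_left[OF C] qinner_qadj_right[OF C])
  have X: "X \<in> qbounded_ops"
    by (simp add: X_def qbounded_ops_diff qbounded_ops_scaleR qbounded_ops_id S)
  have symX: "qinner (X u) v = qinner u (X v)" for u v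
    by (simp add: X_def blinfun.bilinear_simps qinner_simps symS)
  have Cu: "norm (C u) \<le> c * norm u" for u
    by (rule order_trans[OF norm_blinfun]) (intro mult_right_mono c norm_ge_zero)
  \<comment> \<open>Bounding \<open>S u\<close> by \<open>C u\<close> rather than by
    \<open>u\<close> lets the quadratic term in the expansion of \<open>|X u|^2\<close> be absorbed
    by the linear one.\<close>
  have nS: "norm (S u) \<le> c * norm (C u)" for u
  proof -
    have "norm (S u) * norm (S u) = qRe (qinner (C (S u)) (C u))"
      using SC[of "S u" u] qRe_qinner_self[of "S u"] by (simp add: power2_eq_square)
    also have "\<dots> \<le> norm (C (S u)) * norm (C u)" by (rule qRe_qinner_le)
    also have "\<dots> \<le> (c * norm (S u)) * norm (C u)" by (intro mult_right_mono Cu norm_ge_zero)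
    finally have "norm (S u) * norm (S u) \<le> c * norm (C u) * norm (S u)" by (simp add: mult_ac)
    then show ?thesis
      using c by (cases "norm (S u) = 0") (auto intro: mult_right_le_imp_le)
  qed
  have "norm (X u) \<le> 1 * norm u" for u
  proof -
    define k where "k = 1 / c\<^sup>2"
    have k: "0 < k" "k * c\<^sup>2 = 1" using c by (simp_all add: k_def)
    have "qRe (qinner (X u) (X u)) =
        qRe (qinner u u) - 2 * k * qRe (qinner (C u) (C u)) + k\<^sup>2 * qRe (qinner (S u) (S u))"
      unfolding X_def k_def[symmetric] using symS[of u u] SC[of u u]
      by (simp add: blinfun.bilinear_simps qinner_simps power2_eq_square algebra_simps)
    then have "(norm (X u))\<^sup>2 =
        (norm u)\<^sup>2 - 2 * k * (norm (C u))\<^sup>2 + k\<^sup>2 * (norm (S u))\<^sup>2"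
      by (simp only: qRe_qinner_self)
    also have "k\<^sup>2 * (norm (S u))\<^sup>2 \<le> k\<^sup>2 * (c * norm (C u))\<^sup>2"
      using nS[of u] by (intro mult_left_mono power_mono) auto
    also have "k\<^sup>2 * (c * norm (C u))\<^sup>2 = (k * c\<^sup>2) * (k * (norm (C u))\<^sup>2)"
      by (simp add: power2_eq_square)
    also have "\<dots> = k * (norm (C u))\<^sup>2" using k by simp
    finally have "(norm (X u))\<^sup>2 \<le> (norm u)\<^sup>2 - k * (norm (C u))\<^sup>2" by simp
    also have "\<dots> \<le> (norm u)\<^sup>2" using k by simp
    finally show ?thesis using power2_le_imp_le[OF _ norm_ge_zero] by simp
  qed
  then have nX: "norm X \<le> 1" by (intro norm_blinfun_bound) auto
  obtain Y where nY: "norm Y \<le> 1"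
    and YY: "2 *\<^sub>R Y = X + (Y o\<^sub>L Y)"
    and cl: "\<forall>Q. closed Q \<and> 0 \<in> Q \<and> (\<forall>Z\<in>Q. (1/2) *\<^sub>R (X + (Z o\<^sub>L Z)) \<in> Q) \<longrightarrow> Y \<in> Q"
    by (rule ex_sqrt_fixpoint[OF nX])
  have closedI: "Y \<in> Q"
    if "closed Q" "0 \<in> Q" "\<And>Z. Z \<in> Q \<Longrightarrow> (1/2) *\<^sub>R (X + (Z o\<^sub>L Z)) \<in> Q" for Q
    using that cl by blast
  have Y: "Y \<in> qbounded_ops"
    by (intro closedI closed_qbounded_ops qbounded_ops_zero qbounded_ops_scaleR qbounded_ops_add X
        qbounded_ops_compose)
  have "Y \<in> {Z. \<forall>u v. qinner (blinfun_apply Z u) v = qinner u (Z v)}"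
    by (rule closedI, intro closed_Collect_all closed_Collect_eq continuous_intros)
      (simp_all add: blinfun.bilinear_simps qinner_simps symX)
  then have symY: "qinner (Y u) v = qinner u (Y v)" for u v by blast
  define P where "P = c *\<^sub>R (id_blinfun - Y)"
  have "P \<in> qbounded_ops"
    by (simp add: P_def qbounded_ops_diff qbounded_ops_scaleR qbounded_ops_id Y)
  moreover have "qpositive P"
    unfolding qpositive_def
  proof
    fix u
    have "qinner u (P u) = qinner (P u) u"
      by (simp add: P_def blinfun.bilinear_simps qinner_simps symY)
    also have "\<dots> = qcnj (qinner u (P u))" by (rule qinner_qcnj)
    finally have "qinner u (P u) \<in> \<real>"
      by (simp add: quat_Reals_iff quat_eq_iff)
    moreover have "qRe (qinner u (Y u)) \<le> (norm u)\<^sup>2"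
    proof -
      have "qRe (qinner u (Y u)) \<le> norm u * (norm Y * norm u)"
        by (intro order_trans[OF qRe_qinner_le] mult_left_mono norm_blinfun) simp
      also have "\<dots> \<le> norm u * (1 * norm u)"
        by (intro mult_left_mono mult_right_mono nY) auto
      finally show ?thesis by (simp add: power2_eq_square)
    qed
    then have "0 \<le> qRe (qinner u (P u))"
      using c by (simp add: P_def blinfun.bilinear_simps qinner_simps qRe_qinner_self)
    ultimately show "qinner u (P u) \<in> \<real>\<^sub>\<ge>\<^sub>0" by (simp add: quat_nonneg_Reals_iff)
  qed
  moreover have "P o\<^sub>L P = S"
  proof (rule blinfun_eqI)
    fix u
    \<comment> \<open>The fixed point equation amounts to \<open>(1 - Y)^2 = 1 - X\<close>.\<close>
    have "Y (Y u) = 2 *\<^sub>R Y u - X u"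
      using arg_cong[OF YY, of "\<lambda>F. blinfun_apply F u"] by (simp add: blinfun.bilinear_simps)
    then have "(u - Y u) - Y (u - Y u) = (1 / c\<^sup>2) *\<^sub>R S u"
      by (simp add: X_def blinfun.bilinear_simps scaleR_2)
    moreover have "(P o\<^sub>L P) u = (c * c) *\<^sub>R ((u - Y u) - Y (u - Y u))"
      by (simp add: P_def blinfun.bilinear_simps scaleR_right_diff_distrib)
    ultimately show "(P o\<^sub>L P) u = S u" using c by (simp add: power2_eq_square)
  qed
  moreover have "W o\<^sub>L P = P o\<^sub>L W" if W: "W o\<^sub>L S = S o\<^sub>L W" for W
  proof -
    have "W (S u) = S (W u)" for u using W by (simp add: blinfun_commute_iff)
    then have WX: "W (X u) = X (W u)" for u
      by (simp add: X_def blinfun.bilinear_simps)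
    have "Y \<in> {Z. W o\<^sub>L Z = Z o\<^sub>L W}"
    proof (rule closedI[OF closed_commutant])
      fix Z assume "Z \<in> {Z. W o\<^sub>L Z = Z o\<^sub>L W}"
      then show "(1/2) *\<^sub>R (X + (Z o\<^sub>L Z)) \<in> {Z. W o\<^sub>L Z = Z o\<^sub>L W}"
        by (simp add: blinfun_commute_iff blinfun.bilinear_simps WX)
    qed (simp add: blinfun_commute_iff blinfun.bilinear_simps)
    then show ?thesis by (simp add: blinfun_commute_iff P_def blinfun.bilinear_simps)
  qed
  ultimately show ?thesis unfolding S_def by blast
qed

text \<open>The constructed root commutes with everything that commutes with \<open>C* C\<close>, in
  particular with any other root \<open>R\<close>, so uniqueness among commuting roots becomes
  uniqueness among all positive ones.\<close>

lemma qabs_eq: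
  fixes C P :: "'h::quat_hilbert_space \<Rightarrow>\<^sub>L 'h"
  assumes C: "C \<in> qbounded_ops" and P: "P \<in> qbounded_ops" "qpositive P"
    and sq: "P o\<^sub>L P = qadj C o\<^sub>L C"
  shows "qabs C = P"
proof -
  obtain P' where P': "P' \<in> qbounded_ops" "qpositive P'" "P' o\<^sub>L P' = qadj C o\<^sub>L C"
    and comm: "\<And>W. W o\<^sub>L (qadj C o\<^sub>L C) = (qadj C o\<^sub>L C) o\<^sub>L W \<Longrightarrow> W o\<^sub>L P' = P' o\<^sub>L W"
    using ex_qpositive_sqrt[OF C] by blast
  have "R = P'" if R: "R \<in> qbounded_ops \<and> qpositive R \<and> R o\<^sub>L R = qadj C o\<^sub>L C" for R
  proof (rule qpositive_sqrt_unique)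
    have eq: "qadj C o\<^sub>L C = R o\<^sub>L R" using R by simp
    show "P' o\<^sub>L R = R o\<^sub>L P'"
      by (rule comm[symmetric], unfold eq, rule blinfun_eqI) simp
  qed (use R P' in simp_all)
  then have "R = P" if "R \<in> qbounded_ops \<and> qpositive R \<and> R o\<^sub>L R = qadj C o\<^sub>L C" for R
    using that P sq by metis
  then show ?thesis
    unfolding qabs_def qsqrt_def by (intro the_equality conjI P sq)
qed

section \<open>Total real forms and left multiplication by i\<close>

section \<open>Real forms\<close>

abbreviation "qi \<equiv> Quat 0 1 0 0"
abbreviation "qj \<equiv> Quat 0 0 1 0"
abbreviation "qk \<equiv> Quat 0 0 0 1"

lemma qinner_Reals_iff: "qinner u v \<in> \<real> \<longleftrightarrow> qinner u v = qinner v (u::'a::quat_inner)"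
  unfolding qinner_qcnj[of v u] by (auto simp: quat_Reals_iff quat_eq_iff)

text \<open>In the application \<open>C\<close> is the anti self-adjoint part of a normal operator, \<open>B\<close> its absolute
  value, and \<open>\<A>\<close> the self-adjoint part of the bicommutant.\<close>

locale symmetric_algebra =
  fixes \<A> :: "('h::quat_hilbert_space \<Rightarrow>\<^sub>L 'h) set" and B C :: "'h \<Rightarrow>\<^sub>L 'h"
  assumes id_mem: "id_blinfun \<in> \<A>"
    and add_mem: "X \<in> \<A> \<Longrightarrow> Y \<in> \<A> \<Longrightarrow> X + Y \<in> \<A>"
    and scaleR_mem: "X \<in> \<A> \<Longrightarrow> r *\<^sub>R X \<in> \<A>"
    and compose_mem: "X \<in> \<A> \<Longrightarrow> Y \<in> \<A> \<Longrightarrow> X o\<^sub>L Y \<in> \<A>"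
    and mem_qbounded_ops: "X \<in> \<A> \<Longrightarrow> X \<in> qbounded_ops"
    and symmetric: "X \<in> \<A> \<Longrightarrow> qinner (X u) v = qinner u (X v)"
    and commute_C: "X \<in> \<A> \<Longrightarrow> X (C u) = C (X u)"
    and B_mem: "B \<in> \<A>"
    and C_qbounded_ops: "C \<in> qbounded_ops"
    and antisymmetric: "qinner (C u) v = - qinner u (C v)"
    and B_B: "B (B u) = - C (C u)"
begin

text \<open>\<open>Y X\<close> belongs to \<A> again and is therefore symmetric, whereas its adjoint
  is \<open>X Y\<close>.\<close>

lemma commute:
  assumes "X \<in> \<A>" "Y \<in> \<A>"
  shows "X (Y u) = Y (X u)"
proof (rule qinner_eq_cancel_right)
  fix v
  have "qinner v (X (Y u)) = qinner ((Y o\<^sub>L X) v) u"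
    by (simp add: symmetric assms)
  also have "\<dots> = qinner v ((Y o\<^sub>L X) u)" using assms by (intro symmetric compose_mem)
  finally show "qinner v (X (Y u)) = qinner v (Y (X u))" by simp
qed

text \<open>Reality of the inner product is encoded as symmetry, which is equivalent by
  \<open>qinner_Reals_iff\<close> and, being an equation between continuous functions, survives
  closure.\<close>

definition real_form :: "'h set \<Rightarrow> bool"
  where "real_form M \<longleftrightarrow> subspace M \<and> (\<forall>X\<in>\<A>. \<forall>m\<in>M. X m \<in> M) \<and>
    (\<forall>m\<in>M. C m = B m *\<^sub>Q qi) \<and> (\<forall>m\<in>M. \<forall>n\<in>M. qinner m n = qinner n m)"

lemma real_form_closure:
  assumes "real_form M"
  shows "real_form (closure M)"
proof -
  have M: "subspace M" "\<And>X m. X \<in> \<A> \<Longrightarrow> m \<in> M \<Longrightarrow> blinfun_apply X m \<in> M"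
    "\<And>m. m \<in> M \<Longrightarrow> C m = B m *\<^sub>Q qi" "\<And>m n. m \<in> M \<Longrightarrow> n \<in> M \<Longrightarrow> qinner m n = qinner n m"
    using assms by (auto simp: real_form_def)
  have "subspace (closure M)"
  proof (rule subspaceI)
    show "0 \<in> closure M" using subspace_0[OF M(1)] closure_subset by blast
    show "r *\<^sub>R x \<in> closure M" if "x \<in> closure M" for r x
    proof -
      have "(*\<^sub>R) r ` closure M \<subseteq> closure ((*\<^sub>R) r ` M)"
        by (rule closure_bounded_linear_image_subset) (rule bounded_linear_scaleR_right)
      also have "\<dots> \<subseteq> closure M" using M(1) by (intro closure_mono) (auto intro: subspace_scale)
      finally show ?thesis using that by blast
    qed
    show "x + y \<in> closure M" if xy: "x \<in> closure M" "y \<in> closure M" for x y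
    proof -
      obtain f g where fg: "\<And>n. f n \<in> M" "f \<longlonglongrightarrow> x" "\<And>n. g n \<in> M" "g \<longlonglongrightarrow> y"
        using xy unfolding closure_sequential by metis
      then have "(\<lambda>n. f n + g n) \<longlonglongrightarrow> x + y" "\<And>n. f n + g n \<in> M"
        using M(1) by (auto intro: tendsto_add subspace_add)
      then show ?thesis unfolding closure_sequential by (intro exI[of _ "\<lambda>n. f n + g n"]) simp
    qed
  qed
  moreover have "X m \<in> closure M" if "X \<in> \<A>" "m \<in> closure M" for X m
  proof -
    have "X ` closure M \<subseteq> closure (X ` M)"
      by (rule closure_bounded_linear_image_subset) (rule blinfun.bounded_linear_right)
    also have "\<dots> \<subseteq> closure M" using M(2)[OF that(1)] by (intro closure_mono) auto
    finally show ?thesis using that by blast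
  qed
  moreover have "closure M \<subseteq> {m. C m = B m *\<^sub>Q qi}"
    by (rule closure_minimal) (use M(3) in \<open>auto intro!: closed_Collect_eq continuous_intros\<close>)
  moreover have "qinner m n = qinner n m" if "m \<in> closure M" "n \<in> closure M" for m n
  proof -
    \<comment> \<open>Symmetry passes to the closure in one variable at a time.\<close>
    have "closure M \<subseteq> {x. qinner x y = qinner y x}" if "y \<in> M" for y
      by (rule closure_minimal)
        (use M(4) that in \<open>auto intro!: closed_Collect_eq continuous_intros\<close>)
    then have "closure M \<subseteq> {y. qinner m y = qinner y m}"
      using that(1)
      by (intro closure_minimal) (auto intro!: closed_Collect_eq continuous_intros)
    then show ?thesis using that(2) by blast
  qed
  ultimately show ?thesis unfolding real_form_def by blast
qed

text \<open>Upper bounds for Zorn's lemma: two vectors of the union lie in a common member of the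
  chain, which settles the conditions on pairs.\<close>

lemma real_form_Union_chain:
  assumes "K \<noteq> {}" "subset.chain (Collect real_form) K"
  shows "real_form (\<Union>K)"
proof -
  have K: "\<And>M. M \<in> K \<Longrightarrow> real_form M" and ch: "\<And>M N. M \<in> K \<Longrightarrow> N \<in> K \<Longrightarrow> M \<subseteq> N \<or> N \<subseteq> M"
    using assms(2) by (auto simp: subset.chain_def)
  have pair: "\<exists>M\<in>K. x \<in> M \<and> y \<in> M" if "x \<in> \<Union>K" "y \<in> \<Union>K" for x y
    using that ch by (meson UnionE subsetD)
  have sub: "subspace M" if "M \<in> K" for M using K[OF that] by (simp add: real_form_def)
  have "subspace (\<Union>K)"
  proof (rule subspaceI)
    obtain M where "M \<in> K" using assms(1) by blast
    then show "0 \<in> \<Union>K" using sub[of M] subspace_0 by blast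
    show "x + y \<in> \<Union>K" if "x \<in> \<Union>K" "y \<in> \<Union>K" for x y
    proof -
      from pair[OF that] obtain M where "M \<in> K" "x \<in> M" "y \<in> M" by blast
      then show ?thesis using sub[of M] subspace_add by blast
    qed
    show "r *\<^sub>R x \<in> \<Union>K" if "x \<in> \<Union>K" for r x
    proof -
      from that obtain M where "M \<in> K" "x \<in> M" by blast
      then show ?thesis using sub[of M] subspace_scale by blast
    qed
  qed
  moreover have "qinner m n = qinner n m" if "m \<in> \<Union>K" "n \<in> \<Union>K" for m n
  proof -
    from pair[OF that] obtain M where "M \<in> K" "m \<in> M" "n \<in> M" by blast
    then show ?thesis using K[of M] by (simp add: real_form_def)
  qed
  moreover have "X m \<in> \<Union>K" "C m = B m *\<^sub>Q qi" if "X \<in> \<A>" "m \<in> \<Union>K" for X m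
  proof -
    from that obtain M where "M \<in> K" "m \<in> M" by blast
    then have "X m \<in> M" "C m = B m *\<^sub>Q qi" using K[of M] that(1) by (simp_all add: real_form_def)
    then show "X m \<in> \<Union>K" "C m = B m *\<^sub>Q qi" using \<open>M \<in> K\<close> by blast+
  qed
  ultimately show ?thesis using id_mem unfolding real_form_def by blast
qed

text \<open>The orbit of \<open>u\<close> is orthogonal to \<open>M\<close> because \<A> is
  symmetric and leaves \<open>M\<close> invariant. Commutativity of \<A> makes inner products within
  the orbit real, and commutation with \<open>C\<close> carries the equation for \<open>u\<close>
  along the orbit.\<close>

lemma real_form_extend:
  assumes "real_form M" and orth: "\<And>m. m \<in> M \<Longrightarrow> qinner m u = 0" and u: "C u = B u *\<^sub>Q qi"
  shows "real_form {m + blinfun_apply X u | m X. m \<in> M \<and> X \<in> \<A>}" (is "real_form ?N")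
proof -
  have M: "subspace M" "\<And>X m. X \<in> \<A> \<Longrightarrow> m \<in> M \<Longrightarrow> blinfun_apply X m \<in> M"
    "\<And>m. m \<in> M \<Longrightarrow> C m = B m *\<^sub>Q qi" "\<And>m n. m \<in> M \<Longrightarrow> n \<in> M \<Longrightarrow> qinner m n = qinner n m"
    using assms by (auto simp: real_form_def)
  have "subspace ?N"
  proof (rule subspaceI)
    have "0 \<in> \<A>" using scaleR_mem[OF id_mem, of 0] by simp
    then show "0 \<in> ?N" using subspace_0[OF M(1)] by force
    show "x + y \<in> ?N" if "x \<in> ?N" "y \<in> ?N" for x y
    proof -
      from that obtain m X n Y where *: "x = m + blinfun_apply X u" "y = n + blinfun_apply Y u"
        "m \<in> M" "n \<in> M" "X \<in> \<A>" "Y \<in> \<A>"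
        by blast
      then have "x + y = (m + n) + (X + Y) u" by (simp add: blinfun.bilinear_simps)
      then show ?thesis using * M(1) add_mem subspace_add by blast
    qed
    show "r *\<^sub>R x \<in> ?N" if "x \<in> ?N" for r x
    proof -
      from that obtain m X where *: "x = m + blinfun_apply X u" "m \<in> M" "X \<in> \<A>" by blast
      then have "r *\<^sub>R x = r *\<^sub>R m + (r *\<^sub>R X) u"
        by (simp add: blinfun.bilinear_simps scaleR_right_distrib)
      then show ?thesis using * M(1) scaleR_mem subspace_scale by blast
    qed
  qed
  moreover have "Y x \<in> ?N" if "Y \<in> \<A>" "x \<in> ?N" for Y x
  proof -
    from that obtain m X where *: "x = m + blinfun_apply X u" "m \<in> M" "X \<in> \<A>" by blast
    then have "Y x = Y m + (Y o\<^sub>L X) u" by (simp add: blinfun.bilinear_simps)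
    then show ?thesis using * M(2) that(1) compose_mem by blast
  qed
  moreover have "C x = B x *\<^sub>Q qi" if "x \<in> ?N" for x
  proof -
    from that obtain m X where *: "x = m + blinfun_apply X u" "m \<in> M" "X \<in> \<A>" by blast
    have "C (X u) = X (B u *\<^sub>Q qi)" using commute_C[OF *(3), of u] u by simp
    also have "\<dots> = B (X u) *\<^sub>Q qi"
      by (simp add: qbounded_opsD[OF mem_qbounded_ops] *(3) commute[OF B_mem *(3)])
    finally show ?thesis using * M(3) by (simp add: blinfun.bilinear_simps scaleQ_add_left)
  qed
  moreover have "qinner x y = qinner y x" if "x \<in> ?N" "y \<in> ?N" for x y
  proof -
    from that obtain m X n Y where *: "x = m + blinfun_apply X u" "y = n + blinfun_apply Y u"
      "m \<in> M" "n \<in> M" "X \<in> \<A>" "Y \<in> \<A>"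
      by blast
    have 0: "qinner m (Z u) = 0" "qinner (Z u) m = 0" if "Z \<in> \<A>" "m \<in> M" for Z m
    proof -
      show "qinner m (Z u) = 0" using orth[OF M(2)[OF that]] symmetric[OF that(1)] by simp
      then show "qinner (Z u) m = 0" using qinner_qcnj[of "Z u" m] by (simp add: quat_eq_iff)
    qed
    have "qinner (X u) (Y u) = qinner (Y u) (X u)"
      using symmetric[of X u "Y u"] symmetric[of Y u "X u"] commute[of X Y u] * by simp
    then show ?thesis using * 0 M(4)[of m n] by (simp add: qinner_simps)
  qed
  ultimately show ?thesis unfolding real_form_def by blast
qed

text \<open>The real linear map \<open>L u = (C u) i\<close> satisfies \<open>L\<^sup>2 = B\<^sup>2\<close> and commutes with \<open>B\<close>, hence
  \<open>(B + L) (B - L) = 0\<close>, and the claim asks for an element of the kernel of \<open>B + L\<close>: take \<open>(B - L) u\<close>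
  or, if that vanishes, \<open>u j\<close>, since right multiplication by \<open>j\<close> exchanges the kernels of
  \<open>B - L\<close> and \<open>B + L\<close>.\<close>

lemma ex_eigenvector_orth:
  assumes "real_form M" and orth: "\<And>m. m \<in> M \<Longrightarrow> qinner m u = 0" and "u \<noteq> 0"
  shows "\<exists>w. w \<noteq> 0 \<and> (\<forall>m\<in>M. qinner m w = 0) \<and> C w = B w *\<^sub>Q qi"
proof (cases "B u = C u *\<^sub>Q qi")
  case True
  have "C (u *\<^sub>Q qj) = B (u *\<^sub>Q qj) *\<^sub>Q qi"
    by (simp add: qbounded_opsD[OF C_qbounded_ops] qbounded_opsD[OF mem_qbounded_ops[OF B_mem]]
        True scaleQ_scaleQ times_quat_def)
  moreover have "norm (u *\<^sub>Q qj) \<noteq> 0"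
    using assms(3) by (simp add: norm_scaleQ norm_quat_def)
  then have "u *\<^sub>Q qj \<noteq> 0" by auto
  ultimately show ?thesis using orth by (metis mult_zero_left qinner_scaleQ_right)
next
  case False
  define w where "w = B u - C u *\<^sub>Q qi"
  have "qinner m w = 0" if m: "m \<in> M" for m
  proof -
    have Bm: "B m \<in> M" "C m = B m *\<^sub>Q qi" using assms(1) m B_mem by (auto simp: real_form_def)
    have "qinner m (B u) = 0" using symmetric[OF B_mem, of m u] orth[OF Bm(1)] by simp
    \<comment> \<open>\<open>C m\<close> is a right multiple of \<open>B m\<close>, a vector of
      \<open>M\<close>, so \<open>C\<close> also preserves orthogonality to
      \<open>M\<close>.\<close>
    moreover have "qinner m (C u) = 0"
      using antisymmetric[of m u] orth[OF Bm(1)] by (simp add: Bm(2) qinner_scaleQ_left)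
    ultimately show ?thesis by (simp add: w_def qinner_simps qinner_scaleQ_right)
  qed
  moreover have "qi * qi = - 1" by (simp add: quat_eq_iff)
  then have "C w = B w *\<^sub>Q qi"
    by (simp add: w_def blinfun.bilinear_simps scaleQ_diff_left scaleQ_scaleQ
        qbounded_opsD[OF C_qbounded_ops] qbounded_opsD[OF mem_qbounded_ops[OF B_mem]]
        B_B scaleQ_minus_left commute_C[OF B_mem] scaleQ_minus_right scaleQ_one)
  ultimately show ?thesis using False by (intro exI[of _ w]) (simp add: w_def)
qed

lemma ex_total_real_form:
  "\<exists>M. real_form M \<and> closed M \<and> (\<forall>u. (\<forall>m\<in>M. qinner m u = 0) \<longrightarrow> u = 0)"
proof -
  have "real_form {0}"
    by (auto simp: real_form_def subspace_single_0 blinfun.bilinear_simps scaleQ_zero_left)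
  then obtain M where M: "real_form M" and max: "\<And>N. real_form N \<Longrightarrow> M \<subseteq> N \<Longrightarrow> N = M"
    using subset_Zorn_nonempty[of "Collect real_form"] real_form_Union_chain by auto
  have "closed M"
    using max[OF real_form_closure[OF M] closure_subset] by (metis closed_closure)
  moreover have "u = 0" if orth: "\<And>m. m \<in> M \<Longrightarrow> qinner m u = 0" for u
  proof (rule ccontr)
    assume "u \<noteq> 0"
    then obtain w where w: "w \<noteq> 0" "\<And>m. m \<in> M \<Longrightarrow> qinner m w = 0" "C w = B w *\<^sub>Q qi"
      using ex_eigenvector_orth[OF M orth] by blast
    define N where "N = {m + blinfun_apply X w | m X. m \<in> M \<and> X \<in> \<A>}"
    have "real_form N" unfolding N_def using M w(2,3) by (rule real_form_extend)
    moreover have "M \<subseteq> N"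
    proof
      fix m assume "m \<in> M"
      moreover have "m = m + (0 *\<^sub>R id_blinfun) w" by (simp add: blinfun.bilinear_simps)
      ultimately show "m \<in> N" unfolding N_def using scaleR_mem[OF id_mem] by blast
    qed
    ultimately have "N = M" by (rule max)
    \<comment> \<open>Maximality forces \<open>w\<close> into \<open>M\<close>, so \<open>w\<close>
      is orthogonal to itself.\<close>
    moreover have "w = 0 + id_blinfun w" by simp
    then have "w \<in> N" unfolding N_def using subspace_0 M id_mem unfolding real_form_def by blast
    ultimately show False using w(1) w(2)[of w] qinner_self_eq_0 by blast
  qed
  ultimately show ?thesis using M by blast
qed

text \<open>The coordinates are the projections onto \<open>M\<close> of \<open>x\<close> and of its
  right multiples by -i, -j, -k, taken for the real part of the inner product. They reproduce the
  four components of \<open>qinner m x\<close>, and totality kills the remainder.\<close>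

lemma real_form_coordinates:
  assumes "real_form M" "closed M" and total: "\<And>u. (\<And>m. m \<in> M \<Longrightarrow> qinner m u = 0) \<Longrightarrow> u = 0"
  shows "\<exists>a\<in>M. \<exists>b\<in>M. \<exists>c\<in>M. \<exists>d\<in>M. x = a + b *\<^sub>Q qi + c *\<^sub>Q qj + d *\<^sub>Q qk"
proof -
  have M: "subspace M" "\<And>m n. m \<in> M \<Longrightarrow> n \<in> M \<Longrightarrow> qinner m n \<in> \<real>"
    using assms(1) by (auto simp: real_form_def qinner_Reals_iff)
  have proj: "\<exists>p\<in>M. \<forall>m\<in>M. qRe (qinner m p) = qRe (qinner m x * q)" for q
  proof -
    have "bounded_linear (\<lambda>v. qRe (qinner (x *\<^sub>Q q) v))"
      by (intro bounded_linear_compose[OF bounded_linear_qRe]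
          bounded_bilinear.bounded_linear_right[OF bounded_bilinear_qinner])
    from riesz_closed_subspace[OF M(1) assms(2) this]
    obtain p where p: "p \<in> M" "\<And>m. m \<in> M \<Longrightarrow> qRe (qinner p m) = qRe (qinner (x *\<^sub>Q q) m)"
      by blast
    have "qRe (qinner m p) = qRe (qinner m x * q)" if "m \<in> M" for m
      using p(2)[OF that] qRe_qinner_commute[of p m] qRe_qinner_commute[of "x *\<^sub>Q q" m]
      by (simp only: qinner_scaleQ_right)
    then show ?thesis using p(1) by blast
  qed
  obtain a where a: "a \<in> M" "\<And>m. m \<in> M \<Longrightarrow> qRe (qinner m a) = qRe (qinner m x)"
    using proj[of 1] by auto
  obtain b where b: "b \<in> M" "\<And>m. m \<in> M \<Longrightarrow> qRe (qinner m b) = qI (qinner m x)"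
    using proj[of "- qi"] by auto
  obtain c where c: "c \<in> M" "\<And>m. m \<in> M \<Longrightarrow> qRe (qinner m c) = qJ (qinner m x)"
    using proj[of "- qj"] by auto
  obtain d where d: "d \<in> M" "\<And>m. m \<in> M \<Longrightarrow> qRe (qinner m d) = qK (qinner m x)"
    using proj[of "- qk"] by auto
  have "x - (a + b *\<^sub>Q qi + c *\<^sub>Q qj + d *\<^sub>Q qk) = 0"
  proof (rule total)
    fix m assume m: "m \<in> M"
    show "qinner m (x - (a + b *\<^sub>Q qi + c *\<^sub>Q qj + d *\<^sub>Q qk)) = 0"
      using M(2)[OF m a(1)] M(2)[OF m b(1)] M(2)[OF m c(1)] M(2)[OF m d(1)]
      by (simp add: qinner_simps qinner_scaleQ_right quat_Reals_iff quat_eq_iff a b c d m)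
  qed
  then show ?thesis using a(1) b(1) c(1) d(1) by (metis eq_iff_diff_eq_0)
qed

text \<open>A total real form \<open>M\<close> identifies the space with the tensor product over the reals of \<open>M\<close>
  and the quaternions; \<open>J\<close> is left multiplication by \<open>i\<close> on the second factor. It is characterised
  by \<open>qinner m (J x) = qi * qinner m x\<close> for \<open>m \<in> M\<close>, which makes its algebraic properties immediate.\<close>

lemma ex_left_multiplication:
  "\<exists>J\<in>qbounded_ops. (\<forall>u v. qinner (blinfun_apply J u) v = - qinner u (J v)) \<and>
    (\<forall>u. J (J u) = - u) \<and> (\<forall>X\<in>\<A>. \<forall>u. J (blinfun_apply X u) = X (J u)) \<and> (\<forall>u. J (B u) = C u)"
proof -
  obtain M where rf: "real_form M" and "closed M"
    and total: "\<And>u. (\<And>m. m \<in> M \<Longrightarrow> qinner m u = 0) \<Longrightarrow> u = 0"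
    using ex_total_real_form by blast
  note coord = real_form_coordinates[OF this]
  have real: "\<And>m n. m \<in> M \<Longrightarrow> n \<in> M \<Longrightarrow> qinner m n \<in> \<real>"
    using rf by (auto simp: real_form_def qinner_Reals_iff)
  have eqI: "y = z" if "\<And>m. m \<in> M \<Longrightarrow> qinner m y = qinner m z" for y z
    using total[of "y - z"] that by (simp add: qinner_simps)
  have "\<exists>y. \<forall>m\<in>M. qinner m y = qi * qinner m x" for x
  proof -
    obtain a b c d where M: "a \<in> M" "b \<in> M" "c \<in> M" "d \<in> M"
      and x: "x = a + b *\<^sub>Q qi + c *\<^sub>Q qj + d *\<^sub>Q qk"
      using coord[of x] by blast
    \<comment> \<open>Multiply the coefficients by i on the left: the inner products of
      \<open>m\<close> with \<open>a\<close>, \<open>b\<close>, \<open>c\<close>, \<open>d\<close>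
      are real and commute with i.\<close>
    have "qinner m (a *\<^sub>Q qi + b *\<^sub>Q (qi * qi) + c *\<^sub>Q (qi * qj) + d *\<^sub>Q (qi * qk)) = qi * qinner m x"
      if m: "m \<in> M" for m
      using real[OF m M(1)] real[OF m M(2)] real[OF m M(3)] real[OF m M(4)]
      by (simp add: x qinner_simps qinner_scaleQ_right quat_Reals_iff quat_eq_iff)
    then show ?thesis by blast
  qed
  then obtain j where j: "\<And>m x. m \<in> M \<Longrightarrow> qinner m (j x) = qi * qinner m x" by metis
  have j_add: "j (x + y) = j x + j y" for x y
    by (rule eqI) (simp add: j qinner_simps distrib_left)
  have j_scaleR: "j (r *\<^sub>R x) = r *\<^sub>R j x" for r x
    by (rule eqI) (simp add: j qinner_simps)
  have j_scaleQ: "j (x *\<^sub>Q q) = j x *\<^sub>Q q" for x q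
    by (rule eqI) (simp add: j qinner_scaleQ_right mult.assoc)
  have j_j: "j (j x) = - x" for x
  proof (rule eqI)
    have "qi * (qi * a) = - a" for a by (simp add: quat_eq_iff)
    then show "qinner m (j (j x)) = qinner m (- x)" if "m \<in> M" for m
      by (simp add: j that qinner_simps)
  qed
  have j_anti: "qinner (j x) y = - qinner x (j y)" for x y
  proof -
    \<comment> \<open>On \<open>M\<close> the map \<open>j\<close> is right multiplication by i, as
      inner products there are real. Sums of vectors \<open>m *\<^sub>Q q\<close> exhaust the space
      by \<open>coord\<close>.\<close>
    have M: "qinner (j x) (m *\<^sub>Q q) = - qinner x (j (m *\<^sub>Q q))" if m: "m \<in> M" for m q
    proof -
      have jm: "j m = m *\<^sub>Q qi"
      proof (rule eqI)
        show "qinner n (j m) = qinner n (m *\<^sub>Q qi)" if n: "n \<in> M" for n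
          using quat_Reals_commute[OF real[OF n m], of qi] by (simp add: j n qinner_scaleQ_right)
      qed
      have "qinner (j x) m = qcnj (qi * qinner m x)"
        using qinner_qcnj[of "j x" m] by (simp add: j m)
      also have "\<dots> = - (qinner x m * qi)"
        unfolding qinner_qcnj[of x m] by (simp add: quat_eq_iff)
      finally show ?thesis
        by (simp add: j_scaleQ jm qinner_scaleQ_right)
    qed
    obtain a b c d where "a \<in> M" "b \<in> M" "c \<in> M" "d \<in> M"
      and y: "y = a *\<^sub>Q 1 + b *\<^sub>Q qi + c *\<^sub>Q qj + d *\<^sub>Q qk"
      using coord[of y] by (metis scaleQ_one)
    then show ?thesis by (simp only: y j_add qinner_simps M minus_add_distrib)
  qed
  have norm_j: "norm (j x) = norm x" for x
    using j_anti[of x "j x"] by (simp add: norm_eq_sqrt_qinner j_j qinner_simps)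
  have "bounded_linear j"
    by (rule bounded_linear_intro[where K = 1]) (simp_all add: j_add j_scaleR norm_j)
  then have J: "blinfun_apply (Blinfun j) = j" by (rule bounded_linear_Blinfun_apply)
  have j_X: "j (X u) = X (j u)" if X: "X \<in> \<A>" for X u
  proof (rule eqI)
    fix m assume m: "m \<in> M"
    then have "X m \<in> M" using rf X by (auto simp: real_form_def)
    then show "qinner m (j (X u)) = qinner m (X (j u))"
      using m symmetric[OF X, of m u] symmetric[OF X, of m "j u"] by (simp add: j)
  qed
  have j_B: "j (B u) = C u" for u
  proof (rule eqI)
    fix m assume m: "m \<in> M"
    then have "C m = B m *\<^sub>Q qi" using rf by (auto simp: real_form_def)
    then have "qinner m (C u) = - qcnj qi * qinner m (B u)"
      using antisymmetric[of m u] symmetric[OF B_mem, of m u] by (simp add: qinner_scaleQ_left)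
    also have "- qcnj qi = qi" by (simp add: quat_eq_iff)
    finally show "qinner m (j (B u)) = qinner m (C u)" by (simp add: j m)
  qed
  show ?thesis
    by (intro bexI[of _ "Blinfun j"])
      (auto simp: J qbounded_ops_def j_anti j_j j_X j_B j_scaleQ qinner_simps)
qed

end

section \<open>Existence of the decomposition, from the bicommutant of a normal operator\<close>

section \<open>The decomposition of a normal operator\<close>

lemma ex_AJB_decomposition:
  fixes T :: "'h::quat_hilbert_space \<Rightarrow>\<^sub>L 'h"
  assumes T: "T \<in> qbounded_ops" and normal: "qnormal T"
  shows "\<exists>A B J. AJB_decomposition T A B J"
proof -
  define A where "A = (1/2) *\<^sub>R (T + qadj T)"
  define C where "C = (1/2) *\<^sub>R (T - qadj T)"
  note T' = qadj_qbounded_ops[OF T]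
  note adj = qinner_qadj_left[OF T] qinner_qadj_right[OF T, symmetric]
  have normal': "T (qadj T u) = qadj T (T u)" for u
    using normal by (simp add: qnormal_def blinfun_commute_iff)
  have A: "A \<in> qbounded_ops" and C: "C \<in> qbounded_ops"
    by (simp_all add: A_def C_def T T' qbounded_ops_scaleR qbounded_ops_add qbounded_ops_diff)
  have symA: "qinner (A u) v = qinner u (A v)" for u v
    by (simp add: A_def blinfun.bilinear_simps qinner_simps adj add.commute)
  have symC: "qinner (C u) v = - qinner u (C v)" for u v
    by (simp add: C_def blinfun.bilinear_simps qinner_simps adj algebra_simps)
  have adjC: "qadj C = - C"
    by (rule qadj_unique) (simp_all add: qbounded_ops_minus C blinfun.bilinear_simps qinner_simps symC)
  obtain B where B: "B \<in> qbounded_ops" "qpositive B" and BB: "B o\<^sub>L B = qadj C o\<^sub>L C"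
    and comm: "\<And>W. W o\<^sub>L (qadj C o\<^sub>L C) = (qadj C o\<^sub>L C) o\<^sub>L W \<Longrightarrow> W o\<^sub>L B = B o\<^sub>L W"
    using ex_qpositive_sqrt[OF C] by blast
  define commutant :: "('h \<Rightarrow>\<^sub>L 'h) set"
    where "commutant = {Y. (\<forall>u. blinfun_apply Y (T u) = T (Y u)) \<and> (\<forall>u. Y (qadj T u) = qadj T (Y u))}"
  define \<A> :: "('h \<Rightarrow>\<^sub>L 'h) set"
    where "\<A> = {X \<in> qbounded_ops. (\<forall>u v. qinner (blinfun_apply X u) v = qinner u (X v)) \<and>
      (\<forall>Y\<in>commutant. \<forall>u. X (blinfun_apply Y u) = Y (X u))}"
  \<comment> \<open>By normality \<open>T\<close> and its adjoint lie in their own commutant. The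
    bicommutant is thus contained in the commutant and commutative, which makes products of members
    of \<A> symmetric.\<close>
  have TT: "T \<in> commutant" "qadj T \<in> commutant" by (simp_all add: commutant_def normal')
  have \<A>_commutant: "X \<in> commutant" if "X \<in> \<A>" for X
    using that TT by (auto simp: \<A>_def commutant_def)
  have AB: "A \<in> \<A>" "B \<in> \<A>"
  proof -
    show "A \<in> \<A>"
      by (simp add: \<A>_def A symA) (simp add: commutant_def A_def blinfun.bilinear_simps)
    \<comment> \<open>What commutes with \<open>T\<close> and its adjoint commutes with
      \<open>C\<close>, hence with \<open>C* C\<close> and with its root \<open>B\<close>.\<close>
    have "B (Y u) = Y (B u)" if "Y \<in> commutant" for Y u
    proof -
      have "Y (C v) = C (Y v)" for v
        using that by (simp add: commutant_def C_def blinfun.bilinear_simps)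
      then have "Y o\<^sub>L B = B o\<^sub>L Y"
        by (intro comm) (simp add: blinfun_commute_iff adjC blinfun.bilinear_simps)
      then show ?thesis by (simp add: blinfun_commute_iff)
    qed
    then show "B \<in> \<A>" using qpositive_symmetric[OF B] B(1) by (simp add: \<A>_def)
  qed
  interpret symmetric_algebra \<A> B C
  proof
    show "id_blinfun \<in> \<A>" by (simp add: \<A>_def qbounded_ops_id)
    show "X + Y \<in> \<A>" if "X \<in> \<A>" "Y \<in> \<A>" for X Y
      using that by (simp add: \<A>_def qbounded_ops_add blinfun.bilinear_simps qinner_simps)
    show "r *\<^sub>R X \<in> \<A>" if "X \<in> \<A>" for X r
      using that by (simp add: \<A>_def qbounded_ops_scaleR blinfun.bilinear_simps qinner_simps)
    show "X o\<^sub>L Y \<in> \<A>" if XY: "X \<in> \<A>" "Y \<in> \<A>" for X Y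
    proof -
      have "X (Y u) = Y (X u)" for u using XY \<A>_commutant[OF XY(2)] by (simp add: \<A>_def)
      then have "qinner (X (Y u)) v = qinner u (X (Y v))" for u v
        using XY by (simp add: \<A>_def)
      then show ?thesis using XY by (simp add: \<A>_def qbounded_ops_compose)
    qed
    show "X (C u) = C (X u)" if "X \<in> \<A>" for X u
      using \<A>_commutant[OF that] by (simp add: commutant_def C_def blinfun.bilinear_simps)
    show "B (B u) = - C (C u)" for u
      using arg_cong[OF BB, of "\<lambda>F. blinfun_apply F u"] by (simp add: adjC blinfun.bilinear_simps)
  qed (simp_all add: AB C symC, simp_all add: \<A>_def)
  obtain J where J: "J \<in> qbounded_ops" "\<And>u v. qinner (blinfun_apply J u) v = - qinner u (J v)"
    "\<And>u. J (J u) = - u" "\<And>X u. X \<in> \<A> \<Longrightarrow> J (blinfun_apply X u) = X (J u)" "\<And>u. J (B u) = C u"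
    using ex_left_multiplication by blast
  have adjJ: "qadj J = - J"
    by (rule qadj_unique) (simp_all add: qbounded_ops_minus J(1,2) blinfun.bilinear_simps qinner_simps)
  have "T = A + (J o\<^sub>L B)"
    by (rule blinfun_eqI)
      (simp add: blinfun.bilinear_simps J(5) A_def C_def flip: scaleR_right_distrib scaleR_2)
  then have "AJB_decomposition T A B J"
    unfolding AJB_decomposition_def qself_adjoint_iff[OF A] qanti_self_adjoint_def qunitary_def
      op_commute_def blinfun_commute_iff
    using AB by (simp add: A B J(1) symA adjJ J(4) commute[of A B])
      (auto intro!: blinfun_eqI simp: blinfun.bilinear_simps J(3))
  then show ?thesis by blast
qed

section \<open>Uniqueness of the three operators\<close>

lemma
  fixes T A B J :: "'h::quat_hilbert_space \<Rightarrow>\<^sub>L 'h"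
  assumes "AJB_decomposition T A B J"
  shows AJB_decomposition_J: "J (J u) = - u" "qinner (J u) v = - qinner u (J v)"
    and AJB_decomposition_JB: "J (B u) = B (J u)"
    and qadj_AJB_decomposition: "qadj T = A - (J o\<^sub>L B)"
proof -
  have A: "A \<in> qbounded_ops" and B: "B \<in> qbounded_ops" "qpositive B" and J: "J \<in> qbounded_ops"
    and T: "T = A + (J o\<^sub>L B)" and symA: "\<And>u v. qinner (A u) v = qinner u (A v)"
    and adjJ: "qadj J = - J" and JJ: "J o\<^sub>L qadj J = id_blinfun"
    and BJ: "\<And>u. B (J u) = J (B u)"
    using assms qself_adjoint_iff
    by (auto simp: AJB_decomposition_def qanti_self_adjoint_def qunitary_def op_commute_def
        blinfun_commute_iff)
  show "J (J u) = - u" for u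
    using arg_cong[OF JJ, of "\<lambda>F. blinfun_apply F u"]
    by (simp add: adjJ blinfun.bilinear_simps minus_equation_iff[of _ u])
  show symJ: "qinner (J u) v = - qinner u (J v)" for u v
    using qinner_qadj_left[OF J, of u v] by (simp add: adjJ blinfun.bilinear_simps qinner_simps minus_equation_iff)
  show "J (B u) = B (J u)" for u by (simp add: BJ)
  \<comment> \<open>\<open>J B\<close> is anti self-adjoint: its adjoint is
    \<open>B J* = - B J = - J B\<close>.\<close>
  show "qadj T = A - (J o\<^sub>L B)"
    by (rule qadj_unique)
      (simp_all add: A B J qbounded_ops_diff qbounded_ops_compose T blinfun.bilinear_simps
        qinner_simps symA symJ qpositive_symmetric[OF B] BJ)
qed

lemma AJB_decomposition_unique:
  fixes T A B J :: "'h::quat_hilbert_space \<Rightarrow>\<^sub>L 'h"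
  assumes "AJB_decomposition T A B J"
  shows "A = (1/2) *\<^sub>R (T + qadj T)" and "B = (1/2) *\<^sub>R qabs (T - qadj T)"
proof -
  note J = AJB_decomposition_J[OF assms] AJB_decomposition_JB[OF assms]
  note adj = qadj_AJB_decomposition[OF assms]
  have B: "B \<in> qbounded_ops" "qpositive B" and "J \<in> qbounded_ops" and T: "T = A + (J o\<^sub>L B)"
    using assms by (auto simp: AJB_decomposition_def)
  show "A = (1/2) *\<^sub>R (T + qadj T)"
    unfolding adj by (simp add: T flip: scaleR_2)
  have diff: "T - qadj T = 2 *\<^sub>R (J o\<^sub>L B)"
    unfolding adj by (simp add: T scaleR_2)
  have JB: "J o\<^sub>L B \<in> qbounded_ops" using B \<open>J \<in> qbounded_ops\<close> by (simp add: qbounded_ops_compose)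
  have adj2: "qadj (2 *\<^sub>R (J o\<^sub>L B)) = - (2 *\<^sub>R (J o\<^sub>L B))"
    by (rule qadj_unique)
      (simp_all add: JB qbounded_ops_minus qbounded_ops_scaleR blinfun.bilinear_simps qinner_simps
        J(2) qpositive_symmetric[OF B] J(3))
  \<comment> \<open>\<open>2 B\<close> itself is recognised as the root, since
    \<open>- (2 J B)^2 = 4 B^2\<close> by \<open>J^2 = - 1\<close> and commutation.\<close>
  have "qabs (2 *\<^sub>R (J o\<^sub>L B)) = 2 *\<^sub>R B"
  proof (rule qabs_eq)
    show "qpositive (2 *\<^sub>R B)"
      using B(2) by (simp add: qpositive_def blinfun.bilinear_simps qinner_simps
          quat_nonneg_Reals_iff quat_Reals_iff)
    show "2 *\<^sub>R B o\<^sub>L 2 *\<^sub>R B = qadj (2 *\<^sub>R (J o\<^sub>L B)) o\<^sub>L 2 *\<^sub>R (J o\<^sub>L B)"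
      unfolding adj2
      by (rule blinfun_eqI) (simp add: blinfun.bilinear_simps J(1) flip: J(3))
  qed (simp_all add: B JB qbounded_ops_scaleR)
  then show "B = (1/2) *\<^sub>R qabs (T - qadj T)" by (simp add: diff)
qed

text \<open>\<open>J\<close> and \<open>J'\<close> agree on the range of \<open>B\<close> and
  commute with \<open>B\<close>, so \<open>B\<close> annihilates the range of \<open>J - J'\<close>.
  As \<open>J - J'\<close> is antisymmetric, it annihilates every vector orthogonal to its
  range.\<close>

lemma AJB_decomposition_unique_J:
  fixes T A B J J' :: "'h::quat_hilbert_space \<Rightarrow>\<^sub>L 'h"
  assumes d: "AJB_decomposition T A B J" and d': "AJB_decomposition T A B J'"
    and u: "u \<in> qorth_comp (qkernel (T - qadj T))"
  shows "J u = J' u"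
proof -
  have T: "T = A + (J o\<^sub>L B)" "T = A + (J' o\<^sub>L B)" using d d' by (simp_all add: AJB_decomposition_def)
  then have "J o\<^sub>L B = J' o\<^sub>L B" by simp
  from arg_cong[OF this, of blinfun_apply] have eq: "J (B v) = J' (B v)" for v
    by (simp add: fun_eq_iff)
  have diff: "T - qadj T = 2 *\<^sub>R (J o\<^sub>L B)"
    unfolding qadj_AJB_decomposition[OF d] by (simp add: T(1) scaleR_2)
  have "J v - J' v \<in> qkernel (T - qadj T)" for v
    unfolding qkernel_def diff
    using AJB_decomposition_JB[OF d, of v] AJB_decomposition_JB[OF d', of v] eq[of v]
    by (simp add: blinfun.bilinear_simps)
  then have orth: "qinner u (J v - J' v) = 0" for v using u by (auto simp: qorth_comp_def)
  define w where "w = J u - J' u"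
  have "qinner w w = - qinner u (J w - J' w)"
    by (subst w_def) (simp add: qinner_simps AJB_decomposition_J(2)[OF d] AJB_decomposition_J(2)[OF d'])
  then have "w = 0" using orth qinner_self_eq_0 by simp
  then show ?thesis by (simp add: w_def)
qed

theorem theoremJ:
  fixes T :: "'h::quat_hilbert_space \<Rightarrow>\<^sub>L 'h"
  assumes "T \<in> qbounded_ops" and "qnormal T"
  shows "(\<exists>A B J. AJB_decomposition T A B J) \<and>
    (\<forall>A B J. AJB_decomposition T A B J \<longrightarrow>
      A = (1/2) *\<^sub>R (T + qadj T) \<and> B = (1/2) *\<^sub>R qabs (T - qadj T)) \<and>
    (\<forall>A B J J'. AJB_decomposition T A B J \<and> AJB_decomposition T A B J' \<longrightarrow>
      (\<forall>u \<in> qorth_comp (qkernel (T - qadj T)). J u = J' u))"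
  using ex_AJB_decomposition[OF assms] AJB_decomposition_unique AJB_decomposition_unique_J
  by blast

end
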